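(* Let $d\ge1$. For every nonzero normalized state $H$ and any pair $(a,r)$ with $H_{a,r}>0$ (an occupied pivot class), $$\Phi(H)=\sum_{u=0}^{r} I_a(u)\sum_{\nu\in\mathcal{A}(H,a,r,u)}\Bigl(\prod_{b,s}W_{b,s}(\nu)\Bigr)\Phi(H^{\nu}).$$ Together with $\Phi(0)=1$, this recurrence counts every invariant completion exactly once.
   Context: Fix an integer $d\ge1$. A normalized state is a finitely supported array $H=(H_{a,r})_{a\ge1,\,1\le r\le d}$ of nonnegative integers. A labeled realization of $H$ is a finite set $V$ with a permutation $\sigma$ and a function $\rho:V\to\{1,\dots,d\}$ constant on cycles of $\sigma$, such that exactly $H_{a,r}$ cycles have length $a$ and value $r$ (fixed points are cycles of length 1). An invariant completion is a $\sigma$-invariant set $E$ of unordered pairs of distinct elements of $V$ such that each $v\in V$ lies in exactly $\rho(v)$ pairs of $E$. $\Phi(H)$ denotes the number of invariant completions of one fixed labeled realization of $H$ (this number depends only on $H$); $\Phi(0)=1$. For $a\ge1$ put $$P_a(x)=(1+x^2)^{\lfloor (a-1)/2\rfloor}(1+x)^{\varepsilon_a},\qquad \varepsilon_a=1\text{ if }a\text{ is even},\ \varepsilon_a=0\text{ if }a\text{ is odd},$$ and $I_a(u)=[x^u]P_a(x)$. Given $H$ and $(a,r)$ with $H_{a,r}>0$, let $h_{b,s}=H_{b,s}-1$ if $(b,s)=(a,r)$ and $h_{b,s}=H_{b,s}$ otherwise. For $b\ge1$ and $1\le s\le d$ let $g_{ab}=\gcd(a,b)$, $\alpha_{ab}=b/g_{ab}$,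 $\beta_{ab}=a/g_{ab}$, and $$K_{a,r;b,s}=\min\{g_{ab},\lfloor r/\alpha_{ab}\rfloor,\lfloor s/\beta_{ab}\rfloor\}.$$ An allocation is a family $\nu=(\nu_{b,s,k})$ of nonnegative integers, $b\ge1$, $1\le s\le d$, $0\le k\le K_{a,r;b,s}$. $\mathcal{A}(H,a,r,u)$ is the set of allocations satisfying $$\sum_{k=0}^{K_{a,r;b,s}}\nu_{b,s,k}=h_{b,s}\ \text{ for all }(b,s),\qquad u+\sum_{b,s}\sum_{k=0}^{K_{a,r;b,s}}k\,\alpha_{ab}\,\nu_{b,s,k}=r.$$ The weights are $$W_{b,s}(\nu)=\frac{h_{b,s}!}{\prod_{k=0}^{K_{a,r;b,s}}\nu_{b,s,k}!}\prod_{k=0}^{K_{a,r;b,s}}\binom{g_{ab}}{k}^{\nu_{b,s,k}}$$ (equal to $1$ when $h_{b,s}=0$), and the next state $H^\nu$ is defined by $$H^\nu_{b,t}=\sum_{s=1}^{d}\ \sum_{\substack{0\le k\le K_{a,r;b,s}\\ s-k\beta_{ab}=t}}\nu_{b,s,k},\qquad b\ge1,\ 1\le t\le d$$ (cycles whose new residual degree is $0$ are dropped). *)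

theory Defs
  imports "HOL-Combinatorics.Permutations" "HOL-Combinatorics.Orbits"
    "HOL-Computational_Algebra.Polynomial"
begin

(* A state is a total function that vanishes outside the index range a >= 1, 1 <= r <= d. *)

type_synonym state = "nat \<Rightarrow> nat \<Rightarrow> nat"

definition normalized_state :: "nat \<Rightarrow> state \<Rightarrow> bool" where
  "normalized_state d H \<longleftrightarrow>
     finite {(a, r). H a r \<noteq> 0} \<and> (\<forall>a r. H a r \<noteq> 0 \<longrightarrow> 1 \<le> a \<and> r \<in> {1..d})"

abbreviation zero_state :: state where
  "zero_state \<equiv> \<lambda>_ _. 0"

(* Since \<sigma> permutes the finite set V, its cycles (fixed points included) are the sets
   orbit \<sigma> v for v in V. *)

definition labeled_realization ::
  "nat \<Rightarrow> state \<Rightarrow> 'v set \<Rightarrow> ('v \<Rightarrow> 'v) \<Rightarrow> ('v \<Rightarrow> nat) \<Rightarrow> bool" where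
  "labeled_realization d H V \<sigma> \<rho> \<longleftrightarrow>
     finite V \<and> \<sigma> permutes V \<and> \<rho> ` V \<subseteq> {1..d} \<and>
     (\<forall>v\<in>V. \<forall>w\<in>orbit \<sigma> v. \<rho> w = \<rho> v) \<and>
     (\<forall>a\<ge>1. \<forall>r\<in>{1..d}.
        card {C \<in> orbit \<sigma> ` V. card C = a \<and> (\<forall>v\<in>C. \<rho> v = r)} = H a r)"

definition invariant_completions ::
  "'v set \<Rightarrow> ('v \<Rightarrow> 'v) \<Rightarrow> ('v \<Rightarrow> nat) \<Rightarrow> 'v set set set" where
  "invariant_completions V \<sigma> \<rho> =
     {E. E \<subseteq> {e. e \<subseteq> V \<and> card e = 2} \<and> (\<lambda>e. \<sigma> ` e) ` E = E \<and>
         (\<forall>v\<in>V. card {e \<in> E. v \<in> e} = \<rho> v)}"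

(* Every normalized state has a labeled realization on a finite set of naturals, and the
   number of invariant completions is the same for all of them. *)

definition Phi :: "nat \<Rightarrow> state \<Rightarrow> nat" where
  "Phi d H = (SOME n. \<exists>(V :: nat set) \<sigma> \<rho>.
     labeled_realization d H V \<sigma> \<rho> \<and> n = card (invariant_completions V \<sigma> \<rho>))"

definition P_poly :: "nat \<Rightarrow> nat poly" where
  "P_poly a = [:1, 0, 1:] ^ ((a - 1) div 2) * [:1, 1:] ^ (if even a then 1 else 0)"

definition I_coeff :: "nat \<Rightarrow> nat \<Rightarrow> nat" where
  "I_coeff a u = coeff (P_poly a) u"

definition remove_pivot :: "state \<Rightarrow> nat \<Rightarrow> nat \<Rightarrow> state" where
  "remove_pivot H a r = (\<lambda>b s. if (b, s) = (a, r) then H b s - 1 else H b s)"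

definition alpha :: "nat \<Rightarrow> nat \<Rightarrow> nat" where
  "alpha a b = b div gcd a b"

definition beta :: "nat \<Rightarrow> nat \<Rightarrow> nat" where
  "beta a b = a div gcd a b"

definition K_max :: "nat \<Rightarrow> nat \<Rightarrow> nat \<Rightarrow> nat \<Rightarrow> nat" where
  "K_max a r b s = Min {gcd a b, r div alpha a b, s div beta a b}"

definition occupied :: "state \<Rightarrow> (nat \<times> nat) set" where
  "occupied h = {(b, s). h b s \<noteq> 0}"

(* An allocation is extended by 0 outside its index range, so that it is determined by its
   entries in that range.  The sum over all (b, s) is taken over the finite set of (b, s)
   with h b s > 0: the first two conditions force \<nu> b s k = 0 for all other (b, s). *)

definition allocations :: "nat \<Rightarrow> state \<Rightarrow> nat \<Rightarrow> nat \<Rightarrow> nat \<Rightarrow> (nat \<Rightarrow> nat \<Rightarrow> nat \<Rightarrow> nat) set" where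
  "allocations d H a r u = (let h = remove_pivot H a r in
     {\<nu>. (\<forall>b s k. \<not> (1 \<le> b \<and> s \<in> {1..d} \<and> k \<le> K_max a r b s) \<longrightarrow> \<nu> b s k = 0) \<and>
         (\<forall>b\<ge>1. \<forall>s\<in>{1..d}. (\<Sum>k=0..K_max a r b s. \<nu> b s k) = h b s) \<and>
         u + (\<Sum>(b, s)\<in>occupied h. \<Sum>k=0..K_max a r b s. k * alpha a b * \<nu> b s k) = r})"

(* The division is exact for allocations, as the entries \<nu> b s k then sum to h b s. *)

definition weight ::
  "state \<Rightarrow> nat \<Rightarrow> nat \<Rightarrow> (nat \<Rightarrow> nat \<Rightarrow> nat \<Rightarrow> nat) \<Rightarrow> nat \<Rightarrow> nat \<Rightarrow> nat" where
  "weight H a r \<nu> b s =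
     fact (remove_pivot H a r b s) div (\<Prod>k=0..K_max a r b s. fact (\<nu> b s k)) *
     (\<Prod>k=0..K_max a r b s. (gcd a b choose k) ^ \<nu> b s k)"

(* The condition s = t + k * beta a b expresses s - k * beta a b = t without truncation. *)

definition next_state ::
  "nat \<Rightarrow> nat \<Rightarrow> nat \<Rightarrow> (nat \<Rightarrow> nat \<Rightarrow> nat \<Rightarrow> nat) \<Rightarrow> state" where
  "next_state d a r \<nu> = (\<lambda>b t.
     if 1 \<le> b \<and> t \<in> {1..d}
     then \<Sum>s=1..d. \<Sum>k | k \<le> K_max a r b s \<and> s = t + k * beta a b. \<nu> b s k
     else 0)"

(* The right-hand side of the recurrence, with F in place of Phi.  Classes (b, s) with
   h b s = 0 have weight 1, so the product may be taken over the remaining ones. *)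

definition recurrence_rhs :: "nat \<Rightarrow> (state \<Rightarrow> nat) \<Rightarrow> state \<Rightarrow> nat \<Rightarrow> nat \<Rightarrow> nat" where
  "recurrence_rhs d F H a r =
     (\<Sum>u=0..r. I_coeff a u *
        (\<Sum>\<nu>\<in>allocations d H a r u.
           (\<Prod>(b, s)\<in>occupied (remove_pivot H a r). weight H a r \<nu> b s) *
           F (next_state d a r \<nu>)))"

end

(* A vertex c of the pivot cycle C determines the edges that meet C by its neighbourhood N, because
   these edges are the images of the edges {c, x}, x in N, under the powers of \<sigma>.  The sets N that
   occur split over the cycles: on C they are the sets of nonzero offsets closed under negation, which
   P_a counts, and on a cycle D of length b they are closed under \<sigma> ^^ a, hence unions of classes
   modulo gcd a b.  Deleting C lowers the degrees on D by k * beta a b if k classes are chosen there,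
   and what remains is a completion of a smaller realization.  An allocation records how many cycles
   of each class receive each k, and the multinomial weights count the ways to distribute them. *)

theory Submission
  imports Defs "HOL-Combinatorics.Cycles" "HOL-Library.Countable"
begin

section \<open>Counting subsets and functions\<close>

text \<open>\<open>Phi\<close> selects a count by \<open>SOME\<close>, so it is of use only once the
  count is known not to depend on the realization, and the argument for this is the recurrence
  itself. The one-step identity is therefore proved for an arbitrary \<open>F\<close> that gives the
  counts on proper subsets of \<open>V\<close>. It serves three times: with a choice supplied by an
  induction, with \<open>Phi d\<close>, and with any \<open>F\<close> that satisfies the recurrence.
  The constants come from edge orbits: the \<open>a * b\<close> pairs between distinct cycles of
  lengths \<open>a\<close> and \<open>b\<close> form \<open>gcd a b\<close> orbits of length
  \<open>lcm a b\<close>. Hence one orbit uses degree \<open>alpha a b\<close> at each vertex of the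
  pivot cycle and \<open>beta a b\<close> at each vertex of the other cycle.\<close>

lemma card_subsets_sum_eq_coeff:
  fixes w :: "'a \<Rightarrow> nat"
  assumes "finite A"
  shows "card {S. S \<subseteq> A \<and> sum w S = u} = coeff (\<Prod>x\<in>A. 1 + monom (1 :: nat) (w x)) u"
proof -
  have monom_sum: "(\<Prod>x\<in>S. monom (1 :: nat) (w x)) = monom 1 (sum w S)" if "finite S" for S
    using that by (induction S) (simp_all add: mult_monom monom_0 one_pCons del: One_nat_def)
  have "(\<Prod>x\<in>A. 1 + monom (1 :: nat) (w x)) = (\<Prod>x\<in>A. monom 1 (w x) + 1)"
    by (simp add: add.commute)
  \<comment> \<open>Expanding the product picks the monomial or \<open>1\<close> at every point;
    \<open>S\<close> collects the points where the monomial is picked.\<close>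
  also have "\<dots> = (\<Sum>S\<in>Pow A. (\<Prod>x\<in>S. monom 1 (w x)) * (\<Prod>x\<in>A - S. 1))"
    by (rule prod_add[OF assms])
  also have "\<dots> = (\<Sum>S\<in>Pow A. monom 1 (sum w S))"
    proof (rule sum.cong[OF refl])
    fix S assume "S \<in> Pow A"
    hence "finite S" using assms finite_subset by blast
    thus "(\<Prod>x\<in>S. monom (1 :: nat) (w x)) * (\<Prod>x\<in>A - S. 1) = monom 1 (sum w S)"
      by (simp only: monom_sum prod.neutral_const mult_1_right)
  qed
  finally have "coeff (\<Prod>x\<in>A. 1 + monom (1 :: nat) (w x)) u
      = (\<Sum>S\<in>Pow A. if sum w S = u then 1 else 0 :: nat)"
    by (simp add: coeff_sum del: One_nat_def)
  also have "\<dots> = card {S \<in> Pow A. sum w S = u}"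
    using assms by (subst sum.inter_filter[symmetric]) simp_all
  finally show ?thesis
    by (simp add: Collect_conj_eq Pow_def)
qed

text \<open>The involution \<open>j \<mapsto> a - j\<close> splits \<open>{1..<a}\<close> into
  \<open>(a - 1) div 2\<close> pairs and, for even \<open>a\<close>, one fixed point. A closed set
  is a free choice of these orbits. A pair adds 2 to the size and the fixed point adds 1, whence the
  factors \<open>1 + x^2\<close> and \<open>1 + x\<close> of \<open>P_poly a\<close>.\<close>

lemma card_symmetric_subsets:
  assumes "a \<ge> 1"
  shows "card {S. S \<subseteq> {1..<a} \<and> (\<forall>j\<in>S. a - j \<in> S) \<and> card S = u} = I_coeff a u"
proof -
  \<comment> \<open>\<open>B\<close> holds the smaller element of every pair and the fixed point;
    \<open>sym\<close> restores the partners.\<close>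
  define B where "B = {1..a div 2}"
  define w :: "nat \<Rightarrow> nat" where "w j = (if 2 * j = a then 1 else 2)" for j
  define sym where "sym T = T \<union> (\<lambda>j. a - j) ` T" for T
  have sym_restrict: "sym (S \<inter> B) = S" if "S \<subseteq> {1..<a}" "\<forall>j\<in>S. a - j \<in> S" for S
  proof
    show "sym (S \<inter> B) \<subseteq> S" using that by (auto simp: sym_def)
    show "S \<subseteq> sym (S \<inter> B)"
    proof
      fix j assume j: "j \<in> S"
      hence lt: "1 \<le> j" "j < a" using that by auto
      have "j = a - (a - j)" using lt by simp
      moreover have "a - j \<in> S" using that j by blast
      ultimately have "j \<in> (\<lambda>i. a - i) ` (S \<inter> B)" if "j \<notin> B"
        using that lt unfolding B_def by (intro image_eqI[of _ _ "a - j"]) auto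
      thus "j \<in> sym (S \<inter> B)" using j unfolding sym_def by blast
    qed
  qed
  have restrict_sym: "sym T \<inter> B = T" if "T \<subseteq> B" for T
  proof
    show "sym T \<inter> B \<subseteq> T"
    proof
      fix x assume x: "x \<in> sym T \<inter> B"
      show "x \<in> T"
      proof (cases "x \<in> T")
        case False
        then obtain j where j: "j \<in> T" "x = a - j" using x by (auto simp: sym_def)
        \<comment> \<open>Both \<open>j\<close> and \<open>a - j\<close> are at most half of
          \<open>a\<close>, so each is exactly half.\<close>
        hence "j = x" using that x unfolding B_def by (auto simp: subset_iff)
        thus ?thesis using j by simp
      qed
    qed
  qed (use that in \<open>auto simp: sym_def\<close>)
  have card_sym: "card (sym T) = sum w T" if "T \<subseteq> B" for T
  proof -
    have "sym T = (\<Union>j\<in>T. {j, a - j})" by (auto simp: sym_def)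
    also have "card \<dots> = (\<Sum>j\<in>T. card {j, a - j})"
    proof (rule card_UN_disjoint)
      show "finite T" using that finite_subset unfolding B_def by blast
      show "\<forall>i\<in>T. \<forall>j\<in>T. i \<noteq> j \<longrightarrow> {i, a - i} \<inter> {j, a - j} = {}"
      proof (intro ballI impI)
        fix i j assume "i \<in> T" "j \<in> T" "i \<noteq> j"
        moreover from this have "1 \<le> i" "2 * i \<le> a" "1 \<le> j" "2 * j \<le> a"
          using that unfolding B_def by (auto simp: subset_iff)
        ultimately show "{i, a - i} \<inter> {j, a - j} = {}" by auto
      qed
    qed auto
    also have "\<dots> = sum w T"
    proof (rule sum.cong[OF refl])
      fix j assume "j \<in> T"
      hence "1 \<le> j" "2 * j \<le> a" using that unfolding B_def by (auto simp: subset_iff)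
      thus "card {j, a - j} = w j" by (auto simp: w_def card_insert_if)
    qed
    finally show ?thesis .
  qed
  have sym_mem: "sym T \<subseteq> {1..<a} \<and> (\<forall>j\<in>sym T. a - j \<in> sym T)" if "T \<subseteq> B" for T
  proof -
    have "1 \<le> j \<and> 2 * j \<le> a" if "j \<in> T" for j
      using that \<open>T \<subseteq> B\<close> unfolding B_def by (auto simp: subset_iff)
    hence "1 \<le> j \<and> j < a \<and> 1 \<le> a - j \<and> a - j < a \<and> a - (a - j) = j" if "j \<in> T" for j
      using that assms by force
    thus ?thesis by (auto simp: sym_def image_iff subset_iff)
  qed
  have "bij_betw (\<lambda>S. S \<inter> B) {S. S \<subseteq> {1..<a} \<and> (\<forall>j\<in>S. a - j \<in> S) \<and> card S = u}
          {T. T \<subseteq> B \<and> sum w T = u}"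
  proof (rule bij_betw_byWitness[where f' = sym])
    show "(\<lambda>S. S \<inter> B) ` {S. S \<subseteq> {1..<a} \<and> (\<forall>j\<in>S. a - j \<in> S) \<and> card S = u}
        \<subseteq> {T. T \<subseteq> B \<and> sum w T = u}"
    proof clarify
      fix S assume S: "S \<subseteq> {1..<a}" "\<forall>j\<in>S. a - j \<in> S" "u = card S"
      thus "S \<inter> B \<subseteq> B \<and> sum w (S \<inter> B) = card S"
        using card_sym[of "S \<inter> B"] sym_restrict[of S] by simp
    qed
    show "sym ` {T. T \<subseteq> B \<and> sum w T = u}
        \<subseteq> {S. S \<subseteq> {1..<a} \<and> (\<forall>j\<in>S. a - j \<in> S) \<and> card S = u}"
      using sym_mem card_sym by blast
  qed (use sym_restrict restrict_sym in auto)
  hence "card {S. S \<subseteq> {1..<a} \<and> (\<forall>j\<in>S. a - j \<in> S) \<and> card S = u}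
      = coeff (\<Prod>x\<in>B. 1 + monom (1 :: nat) (w x)) u"
    using card_subsets_sum_eq_coeff[of B w u] by (simp add: bij_betw_same_card B_def)
  also have "(\<Prod>x\<in>B. 1 + monom (1 :: nat) (w x)) = P_poly a"
  proof -
    \<comment> \<open>The representatives of the genuine pairs; \<open>B\<close> has one more
      element exactly when \<open>a\<close> is even.\<close>
    define B' where "B' = {1..(a - 1) div 2}"
    have monoms: "1 + monom (1 :: nat) 2 = [:1, 0, 1:]" "1 + monom (1 :: nat) (Suc 0) = [:1, 1:]"
      by (simp_all add: monom_altdef numeral_2_eq_2 one_pCons)
    have "(\<Prod>x\<in>B'. 1 + monom (1 :: nat) (w x)) = (\<Prod>x\<in>B'. [:1, 0, 1:])"
    proof (rule prod.cong[OF refl])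
      fix x assume "x \<in> B'"
      hence "2 * x \<noteq> a" using assms by (auto simp: B'_def)
      thus "1 + monom (1 :: nat) (w x) = [:1, 0, 1:]" by (simp add: w_def monoms del: One_nat_def)
    qed
    hence B': "(\<Prod>x\<in>B'. 1 + monom (1 :: nat) (w x)) = [:1, 0, 1:] ^ ((a - 1) div 2)"
      by (simp add: B'_def)
    show ?thesis
    proof (cases "even a")
      case True
      then obtain m where m: "a = 2 * m" by blast
      hence "B = insert m B'" "m \<notin> B'" "w m = 1" "finite B'"
        using assms by (auto simp: B_def B'_def w_def)
      hence "(\<Prod>x\<in>B. 1 + monom (1 :: nat) (w x)) = [:1, 1:] * [:1, 0, 1:] ^ ((a - 1) div 2)"
        using B' by (simp add: monoms(2)[unfolded One_nat_def[symmetric]] del: One_nat_def mult_pCons_left)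
      thus ?thesis using True by (simp only: P_poly_def if_True power_one_right mult.commute)
    next
      case False
      hence "B = B'" using assms by (auto simp: B_def B'_def elim!: oddE)
      thus ?thesis using False B' by (simp add: P_poly_def)
    qed
  qed
  finally show ?thesis by (simp add: I_coeff_def)
qed

text \<open>\<open>{..<b}\<close> consists of \<open>b div g\<close> blocks of \<open>g\<close>
  consecutive numbers, each containing every residue once. On cycles this produces the factor
  \<open>alpha\<close>.\<close>

lemma card_periodic:
  fixes P :: "nat \<Rightarrow> bool"
  assumes "g > 0" "g dvd b"
  shows "card {j. j < b \<and> P (j mod g)} = (b div g) * card {j. j < g \<and> P j}"
proof -
  obtain m where b: "b = g * m" using assms by blast
  have "card {j. j < g * m \<and> P (j mod g)} = m * card {j. j < g \<and> P j}"
  proof (induction m)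
    case (Suc m)
    have "{j. j < g * Suc m \<and> P (j mod g)}
        = {j. j < g * m \<and> P (j mod g)} \<union> (\<lambda>j. g * m + j) ` {j. j < g \<and> P j}" (is "?L = ?A \<union> ?B")
    proof
      show "?L \<subseteq> ?A \<union> ?B"
      proof
        fix j assume j: "j \<in> ?L"
        show "j \<in> ?A \<union> ?B"
        proof (cases "j < g * m")
          case False
          then obtain i where "j = g * m + i" using le_Suc_ex not_less by blast
          thus ?thesis using j by auto
        qed (use j in auto)
      qed
      have "j < g * Suc m" if "j < g * m" for j using that by simp
      thus "?A \<union> ?B \<subseteq> ?L" by auto
    qed
    moreover have "card ?B = card {j. j < g \<and> P j}" by (intro card_image inj_onI) simp
    moreover have "?A \<inter> ?B = {}" by auto
    ultimately show ?case using Suc by (simp add: card_Un_disjoint)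
  qed simp
  thus ?thesis using assms b by simp
qed

text \<open>A subset of a disjoint union is the family of its traces, so conditions that see one
  trace each can be met independently. This makes the number of neighbourhoods a product over
  cycles.\<close>

lemma card_subsets_of_disjoint_Union:
  assumes "finite \<D>" "\<And>D. D \<in> \<D> \<Longrightarrow> finite D" "pairwise disjnt \<D>"
  shows "card {N. N \<subseteq> \<Union>\<D> \<and> (\<forall>D\<in>\<D>. Q D (N \<inter> D))} = (\<Prod>D\<in>\<D>. card {M. M \<subseteq> D \<and> Q D M})"
proof -
  have Union_Int: "(\<Union>(f ` \<D>)) \<inter> D = f D" if "f \<in> PiE \<D> (\<lambda>D. {M. M \<subseteq> D \<and> Q D M})" "D \<in> \<D>" for f D
  proof -
    have "f D' \<inter> D = {}" if "D' \<in> \<D>" "D' \<noteq> D" for D'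
      using that \<open>D \<in> \<D>\<close> assms(3) \<open>f \<in> _\<close> PiE_mem[OF \<open>f \<in> _\<close> that(1)]
      unfolding pairwise_def disjnt_def by blast
    thus ?thesis using that PiE_mem[OF that] by blast
  qed
  have "bij_betw (\<lambda>N. \<lambda>D\<in>\<D>. N \<inter> D) {N. N \<subseteq> \<Union>\<D> \<and> (\<forall>D\<in>\<D>. Q D (N \<inter> D))}
          (PiE \<D> (\<lambda>D. {M. M \<subseteq> D \<and> Q D M}))"
  proof (rule bij_betw_byWitness[where f' = "\<lambda>f. \<Union>(f ` \<D>)"])
    show "\<forall>f\<in>PiE \<D> (\<lambda>D. {M. M \<subseteq> D \<and> Q D M}). (\<lambda>D\<in>\<D>. \<Union>(f ` \<D>) \<inter> D) = f"
      using Union_Int by (auto simp: restrict_def fun_eq_iff PiE_iff extensional_def)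
    show "(\<lambda>f. \<Union>(f ` \<D>)) ` PiE \<D> (\<lambda>D. {M. M \<subseteq> D \<and> Q D M})
        \<subseteq> {N. N \<subseteq> \<Union>\<D> \<and> (\<forall>D\<in>\<D>. Q D (N \<inter> D))}"
    proof clarify
      fix f assume f: "f \<in> PiE \<D> (\<lambda>D. {M. M \<subseteq> D \<and> Q D M})"
      show "\<Union>(f ` \<D>) \<subseteq> \<Union>\<D> \<and> (\<forall>D\<in>\<D>. Q D (\<Union>(f ` \<D>) \<inter> D))"
        using Union_Int[OF f] PiE_mem[OF f] by (auto simp: Union_Int)
    qed
  qed (auto simp: fun_eq_iff)
  thus ?thesis
    using assms by (simp add: bij_betw_same_card card_PiE)
qed

text \<open>The multinomial coefficients of all classes are treated at once: a point of class \<open>t\<close>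
  receives a value in \<open>B t\<close>, and every pair of a class and a value is prescribed how often it occurs.\<close>

lemma card_functions_with_class_counts:
  assumes "finite A" "finite T" "\<And>t. t \<in> T \<Longrightarrow> finite (B t)" "\<tau> ` A \<subseteq> T"
    and "\<And>t. t \<in> T \<Longrightarrow> (\<Sum>k\<in>B t. \<nu> (t, k)) = card {x \<in> A. \<tau> x = t}"
  shows "card {\<kappa> \<in> PiE A (\<lambda>x. B (\<tau> x)). \<forall>p\<in>Sigma T B. card {x \<in> A. (\<tau> x, \<kappa> x) = p} = \<nu> p}
           * (\<Prod>p\<in>Sigma T B. fact (\<nu> p)) = (\<Prod>t\<in>T. fact (card {x \<in> A. \<tau> x = t}))"
  using assms(1,4,5)
proof (induction A arbitrary: \<nu> rule: finite_induct)
  case empty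
  have "\<nu> p = 0" if "p \<in> Sigma T B" for p
    using empty(2)[of "fst p"] that assms(3) by (auto simp: sum_eq_0_iff)
  thus ?case by (simp add: Collect_conv_if)
next
  case (insert x A)
  define cnt where "cnt A \<kappa> p = card {x \<in> A. (\<tau> x, \<kappa> x) = p}" for A and \<kappa> :: "'a \<Rightarrow> 'c" and p
  define F where "F A \<nu> = {\<kappa> \<in> PiE A (\<lambda>x. B (\<tau> x)). \<forall>p\<in>Sigma T B. cnt A \<kappa> p = \<nu> p}"
    for A and \<nu> :: "'b \<times> 'c \<Rightarrow> nat"
  define t where "t = \<tau> x"
  have t: "t \<in> T" using insert.prems(1) by (simp add: t_def)
  have finS: "finite (Sigma T B)" using assms by auto
  have finF: "finite (F A \<nu>)" if "finite A" "\<tau> ` A \<subseteq> T" for A \<nu>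
    using that assms(3) unfolding F_def by (auto intro!: finite_PiE finite_subset[OF Collect_subset])
  have cnt_insert: "cnt (insert x A) \<kappa> p = cnt A \<kappa> p + of_bool (p = (t, \<kappa> x))" for \<kappa> p
  proof -
    have "{y \<in> insert x A. (\<tau> y, \<kappa> y) = p}
        = (if p = (t, \<kappa> x) then insert x {y \<in> A. (\<tau> y, \<kappa> y) = p} else {y \<in> A. (\<tau> y, \<kappa> y) = p})"
      by (auto simp: t_def)
    thus ?thesis using insert.hyps by (simp add: cnt_def)
  qed
  have cnt_cong: "cnt A \<kappa> p = cnt A \<kappa>' p" if "\<And>y. y \<in> A \<Longrightarrow> \<kappa> y = \<kappa>' y" for \<kappa> \<kappa>' p
    unfolding cnt_def using that by (intro arg_cong[where f = card]) auto
  \<comment> \<open>Forgetting the value \<open>k\<close> at \<open>x\<close> lowers the prescribed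
    count of \<open>(t, k)\<close> by one, so the induction hypothesis applies;
    \<open>fact (\<nu> (t, k))\<close> gives up its leading factor
    \<open>\<nu> (t, k)\<close>.\<close>
  have fiber: "card {\<kappa> \<in> F (insert x A) \<nu>. \<kappa> x = k} * (\<Prod>p\<in>Sigma T B. fact (\<nu> p))
      = \<nu> (t, k) * (\<Prod>t\<in>T. fact (card {x \<in> A. \<tau> x = t}))" if k: "k \<in> B t" for k
  proof (cases "\<nu> (t, k) = 0")
    case True
    have "{\<kappa> \<in> F (insert x A) \<nu>. \<kappa> x = k} = {}"
      using True t k by (fastforce simp: F_def cnt_insert)
    thus ?thesis using True by (simp only: card.empty)
  next
    case False
    define \<nu>' where "\<nu>' = \<nu>((t, k) := \<nu> (t, k) - 1)"
    have \<nu>: "\<nu> p = \<nu>' p + of_bool (p = (t, k))" for p using False by (simp add: \<nu>'_def)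
    have "bij_betw (\<lambda>\<kappa>. restrict \<kappa> A) {\<kappa> \<in> F (insert x A) \<nu>. \<kappa> x = k} (F A \<nu>')"
    proof (rule bij_betw_byWitness[where f' = "\<lambda>\<kappa>. \<kappa>(x := k)"])
      show "(\<lambda>\<kappa>. restrict \<kappa> A) ` {\<kappa> \<in> F (insert x A) \<nu>. \<kappa> x = k} \<subseteq> F A \<nu>'"
      proof clarify
        fix \<kappa> assume \<kappa>: "\<kappa> \<in> F (insert x A) \<nu>" "k = \<kappa> x"
        have "cnt A (restrict \<kappa> A) p = \<nu>' p" if "p \<in> Sigma T B" for p
        proof -
          have "cnt (insert x A) \<kappa> p = \<nu> p" using \<kappa> that unfolding F_def by blast
          moreover have "cnt A (restrict \<kappa> A) p = cnt A \<kappa> p" by (rule cnt_cong) simp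
          ultimately show ?thesis using \<nu>[of p] \<kappa>(2) by (simp add: cnt_insert)
        qed
        thus "restrict \<kappa> A \<in> F A \<nu>'" using \<kappa> by (auto simp: F_def)
      qed
      show "(\<lambda>\<kappa>. \<kappa>(x := k)) ` F A \<nu>' \<subseteq> {\<kappa> \<in> F (insert x A) \<nu>. \<kappa> x = k}"
      proof clarify
        fix \<kappa> assume \<kappa>: "\<kappa> \<in> F A \<nu>'"
        have "cnt (insert x A) (\<kappa>(x := k)) p = \<nu> p" if "p \<in> Sigma T B" for p
        proof -
          have "cnt A (\<kappa>(x := k)) p = cnt A \<kappa> p" using insert.hyps by (intro cnt_cong) auto
          thus ?thesis using \<nu>[of p] \<kappa> that unfolding F_def by (auto simp: cnt_insert)
        qed
        moreover have "\<kappa>(x := k) \<in> PiE (insert x A) (\<lambda>x. B (\<tau> x))"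
          using \<kappa> k PiE_fun_upd[of k "\<lambda>x. B (\<tau> x)" x \<kappa> A] by (simp add: F_def t_def)
        ultimately show "\<kappa>(x := k) \<in> F (insert x A) \<nu> \<and> (\<kappa>(x := k)) x = k"
          by (simp add: F_def)
      qed
      show "\<forall>\<kappa>\<in>{\<kappa> \<in> F (insert x A) \<nu>. \<kappa> x = k}. (restrict \<kappa> A)(x := k) = \<kappa>"
        by (auto simp: F_def fun_eq_iff PiE_iff extensional_def)
      show "\<forall>\<kappa>\<in>F A \<nu>'. restrict (\<kappa>(x := k)) A = \<kappa>"
        using insert.hyps by (auto simp: F_def fun_eq_iff PiE_iff extensional_def)
    qed
    hence "card {\<kappa> \<in> F (insert x A) \<nu>. \<kappa> x = k} = card (F A \<nu>')" by (rule bij_betw_same_card)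
    moreover have "(\<Prod>p\<in>Sigma T B. fact (\<nu> p)) = \<nu> (t, k) * (\<Prod>p\<in>Sigma T B. fact (\<nu>' p) :: nat)"
    proof -
      have "(\<Prod>p\<in>Sigma T B. fact (\<nu> p)) = (\<Prod>p\<in>Sigma T B. fact (\<nu>' p) * (if p = (t, k) then \<nu> (t, k) else 1) :: nat)"
        using False by (intro prod.cong refl) (auto simp: \<nu>'_def fact_reduce)
      also have "\<dots> = (\<Prod>p\<in>Sigma T B. fact (\<nu>' p)) * \<nu> (t, k)"
        using finS t k by (simp add: prod.distrib prod.delta)
      finally show ?thesis by simp
    qed
    moreover have "card (F A \<nu>') * (\<Prod>p\<in>Sigma T B. fact (\<nu>' p)) = (\<Prod>t\<in>T. fact (card {x \<in> A. \<tau> x = t}))"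
      unfolding F_def cnt_def
    proof (rule insert.IH)
      fix s assume s: "s \<in> T"
      have "(\<Sum>j\<in>B s. \<nu>' (s, j)) + of_bool (s = t) = (\<Sum>j\<in>B s. \<nu> (s, j))"
        using assms(3)[OF s] k by (auto simp: \<nu> sum.distrib)
      also have "\<dots> = card {y \<in> insert x A. \<tau> y = s}" by (rule insert.prems(2)[OF s])
      also have "{y \<in> insert x A. \<tau> y = s} = (if s = t then insert x {y \<in> A. \<tau> y = s} else {y \<in> A. \<tau> y = s})"
        by (auto simp: t_def)
      finally show "(\<Sum>k\<in>B s. \<nu>' (s, k)) = card {x \<in> A. \<tau> x = s}"
        using insert.hyps by (auto split: if_splits)
    qed (use insert.prems in auto)
    ultimately show ?thesis by (simp add: algebra_simps)
  qed
  have "card (F (insert x A) \<nu>) = (\<Sum>k\<in>B t. card {\<kappa> \<in> F (insert x A) \<nu>. \<kappa> x = k})"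
  proof -
    have "F (insert x A) \<nu> = (\<Union>k\<in>B t. {\<kappa> \<in> F (insert x A) \<nu>. \<kappa> x = k})"
      by (auto simp: F_def t_def)
    also have "card \<dots> = (\<Sum>k\<in>B t. card {\<kappa> \<in> F (insert x A) \<nu>. \<kappa> x = k})"
      using assms(3)[OF t] insert finF by (intro card_UN_disjoint) auto
    finally show ?thesis .
  qed
  hence "card (F (insert x A) \<nu>) * (\<Prod>p\<in>Sigma T B. fact (\<nu> p))
      = (\<Sum>k\<in>B t. \<nu> (t, k)) * (\<Prod>t\<in>T. fact (card {x \<in> A. \<tau> x = t}))"
    by (simp add: sum_distrib_right fiber)
  \<comment> \<open>Over all \<open>k\<close> the leading factors add up to the new size of class
    \<open>t\<close>, which is the factor that its factorial gains on the right.\<close>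
  also have "(\<Sum>k\<in>B t. \<nu> (t, k)) = Suc (card {y \<in> A. \<tau> y = t})"
  proof -
    have "{y \<in> insert x A. \<tau> y = t} = insert x {y \<in> A. \<tau> y = t}" by (auto simp: t_def)
    thus ?thesis using insert.prems(2)[OF t] insert.hyps by simp
  qed
  also have "Suc (card {y \<in> A. \<tau> y = t}) * (\<Prod>t\<in>T. fact (card {x \<in> A. \<tau> x = t}))
      = (\<Prod>s\<in>T. (if s = t then Suc (card {y \<in> A. \<tau> y = t}) else 1) * fact (card {x \<in> A. \<tau> x = s}))"
    using assms(2) t by (simp add: prod.distrib prod.delta)
  also have "\<dots> = (\<Prod>s\<in>T. fact (card {y \<in> insert x A. \<tau> y = s}))"
  proof (rule prod.cong[OF refl])
    fix s
    have "{y \<in> insert x A. \<tau> y = s} = (if s = t then insert x {y \<in> A. \<tau> y = s} else {y \<in> A. \<tau> y = s})"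
      by (auto simp: t_def)
    thus "(if s = t then Suc (card {y \<in> A. \<tau> y = t}) else 1) * fact (card {x \<in> A. \<tau> x = s})
        = fact (card {y \<in> insert x A. \<tau> y = s})"
      using insert.hyps by simp
  qed
  finally show ?case by (simp only: F_def cnt_def)
qed

section \<open>Cycles of a permutation and their closed subsets\<close>

locale finite_perm =
  fixes V :: "'v set" and \<sigma> :: "'v \<Rightarrow> 'v"
  assumes finite_V: "finite V" and permutes: "\<sigma> permutes V"
begin

lemma permutation: "permutation \<sigma>"
  using finite_V permutes by (auto simp: permutation_permutes)

lemma self_in_orbit: "v \<in> orbit \<sigma> v"
  by (rule permutation_self_in_orbit[OF permutation])

lemma orbit_eq: "w \<in> orbit \<sigma> v \<Longrightarrow> orbit \<sigma> w = orbit \<sigma> v"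
  by (rule orbit_cyclic_eq3[OF cyclic_on_orbit'[OF permutation]])

lemma orbit_subset_V: "v \<in> V \<Longrightarrow> orbit \<sigma> v \<subseteq> V"
  by (rule permutes_orbit_subset[OF permutes])

lemma orbit_funpow: "orbit \<sigma> v = range (\<lambda>i. (\<sigma> ^^ i) v)"
  using orbit_altdef_permutation[OF permutation] by auto

lemma funpow_in_orbit_self: "(\<sigma> ^^ i) v \<in> orbit \<sigma> v"
  by (auto simp: orbit_funpow)

lemma finite_orbit_V: "finite (orbit \<sigma> v)"
  by (rule finite_orbit[OF self_in_orbit])

lemma card_orbit_pos: "0 < card (orbit \<sigma> v)"
  using finite_orbit_V self_in_orbit by (auto simp: card_gt_0_iff)

lemma inj_funpow: "inj (\<sigma> ^^ i)"
  using permutes_inj[OF permutes] by (rule inj_fn)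

lemma card_orbit: "card (orbit \<sigma> v) = least_power \<sigma> v"
proof -
  note lp = least_power_of_permutation[OF permutation, of v]
  have "orbit \<sigma> v = (\<lambda>i. (\<sigma> ^^ i) v) ` {..<least_power \<sigma> v}"
    using orbit_altdef_bounded[OF lp] by auto
  moreover have "inj_on (\<lambda>i. (\<sigma> ^^ i) v) {..<least_power \<sigma> v}"
  proof (rule inj_onI)
    fix i j assume ij: "i \<in> {..<least_power \<sigma> v}" "j \<in> {..<least_power \<sigma> v}" "(\<sigma> ^^ i) v = (\<sigma> ^^ j) v"
    have le_case: "i = j" if "i \<le> j" "j < least_power \<sigma> v" "(\<sigma> ^^ i) v = (\<sigma> ^^ j) v" for i j
    proof -
      have "(\<sigma> ^^ i) ((\<sigma> ^^ (j - i)) v) = (\<sigma> ^^ i) v"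
        using that by (metis comp_apply funpow_add le_add_diff_inverse)
      hence "(\<sigma> ^^ (j - i)) v = v" by (rule injD[OF inj_funpow])
      hence "least_power \<sigma> v dvd j - i" by (rule least_power_minimal)
      thus ?thesis using that by (auto dest: dvd_imp_le)
    qed
    show "i = j"
    proof (cases "i \<le> j")
      case True
      show ?thesis by (rule le_case[OF True _ ij(3)]) (use ij in simp)
    next
      case False
      hence "j \<le> i" by simp
      thus ?thesis by (rule le_case[OF _ _ ij(3)[symmetric], symmetric]) (use ij in simp)
    qed
  qed
  ultimately show ?thesis by (simp add: card_image)
qed

lemma funpow_eq_self_iff: "(\<sigma> ^^ i) v = v \<longleftrightarrow> card (orbit \<sigma> v) dvd i"
  using least_power_dvd[OF permutation] by (simp add: card_orbit)

lemma funpow_mod: "(\<sigma> ^^ (i mod card (orbit \<sigma> v))) v = (\<sigma> ^^ i) v"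
proof -
  have "(\<sigma> ^^ i) v = (\<sigma> ^^ (i mod card (orbit \<sigma> v))) ((\<sigma> ^^ (i - i mod card (orbit \<sigma> v))) v)"
    by (metis comp_apply funpow_add le_add_diff_inverse mod_less_eq_dividend)
  also have "(\<sigma> ^^ (i - i mod card (orbit \<sigma> v))) v = v"
    by (simp add: funpow_eq_self_iff)
  finally show ?thesis ..
qed

text \<open>A base point turns a cycle into the residues modulo its length; the counts on cycles
  take place in these coordinates. Injectivity follows from surjectivity, as both sets have the same
  size.\<close>

lemma bij_betw_funpow: "bij_betw (\<lambda>i. (\<sigma> ^^ i) v) {..<card (orbit \<sigma> v)} (orbit \<sigma> v)"
proof -
  have "orbit \<sigma> v \<subseteq> (\<lambda>i. (\<sigma> ^^ i) v) ` {..<card (orbit \<sigma> v)}"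
  proof
    fix w assume "w \<in> orbit \<sigma> v"
    then obtain i where "w = (\<sigma> ^^ i) v"
      using orbit_funpow by blast
    hence "w = (\<sigma> ^^ (i mod card (orbit \<sigma> v))) v"
      by (simp only: funpow_mod)
    thus "w \<in> (\<lambda>i. (\<sigma> ^^ i) v) ` {..<card (orbit \<sigma> v)}" using card_orbit_pos by auto
  qed
  hence "orbit \<sigma> v = (\<lambda>i. (\<sigma> ^^ i) v) ` {..<card (orbit \<sigma> v)}"
    using funpow_in_orbit_self by auto
  thus ?thesis using eq_card_imp_inj_on[of "{..<card (orbit \<sigma> v)}" "\<lambda>i. (\<sigma> ^^ i) v"]
    by (simp add: bij_betw_def)
qed

lemma card_Int_orbit: "card {i. i < card (orbit \<sigma> v) \<and> (\<sigma> ^^ i) v \<in> M} = card (M \<inter> orbit \<sigma> v)"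
proof (rule bij_betw_same_card)
  show "bij_betw (\<lambda>i. (\<sigma> ^^ i) v) {i. i < card (orbit \<sigma> v) \<and> (\<sigma> ^^ i) v \<in> M} (M \<inter> orbit \<sigma> v)"
    unfolding bij_betw_def
  proof
    show "inj_on (\<lambda>i. (\<sigma> ^^ i) v) {i. i < card (orbit \<sigma> v) \<and> (\<sigma> ^^ i) v \<in> M}"
      using bij_betw_imp_inj_on[OF bij_betw_funpow] by (rule inj_on_subset) auto
    show "(\<lambda>i. (\<sigma> ^^ i) v) ` {i. i < card (orbit \<sigma> v) \<and> (\<sigma> ^^ i) v \<in> M} = M \<inter> orbit \<sigma> v"
    proof -
      have "f ` {i. i < b \<and> f i \<in> M} = M \<inter> f ` {..<b}" for f :: "nat \<Rightarrow> 'v" and b by auto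
      thus ?thesis by (simp only: bij_betw_imp_surj_on[OF bij_betw_funpow])
    qed
  qed
qed

section \<open>Subsets of a cycle closed under a power of the permutation\<close>

lemma funpow_closed:
  assumes "\<forall>x\<in>M. (\<sigma> ^^ a) x \<in> M" "x \<in> M"
  shows "(\<sigma> ^^ (a * i)) x \<in> M"
  using assms by (induction i) (auto simp: funpow_add)

text \<open>Closure under \<open>\<sigma> ^^ a\<close> on a cycle of length \<open>b\<close> is closure under \<open>\<sigma> ^^ gcd a b\<close>,
  by Bezout, so the closed sets correspond to sets of residues modulo \<open>gcd a b\<close>.\<close>

lemma closed_subset_orbit_periodic:
  fixes v a
  defines "g \<equiv> gcd a (card (orbit \<sigma> v))"
  assumes "a > 0" "M \<subseteq> orbit \<sigma> v" "\<forall>x\<in>M. (\<sigma> ^^ a) x \<in> M"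
  shows "(\<sigma> ^^ i) v \<in> M \<longleftrightarrow> (\<sigma> ^^ (i mod g)) v \<in> M"
proof -
  define b where "b = card (orbit \<sigma> v)"
  have b: "b > 0" by (simp add: b_def card_orbit_pos)
  \<comment> \<open>\<open>x\<close> applications of \<open>\<sigma> ^^ a\<close> advance by
    \<open>g\<close> after \<open>y\<close> full turns.\<close>
  obtain x y where xy: "a * x = b * y + g"
    using bezout_nat[of a b] assms(2) by (auto simp: g_def b_def)
  have step: "(\<sigma> ^^ (i + g)) v \<in> M" if "(\<sigma> ^^ i) v \<in> M" for i
  proof -
    have "(\<sigma> ^^ (a * x)) ((\<sigma> ^^ i) v) \<in> M" using assms(4) that by (rule funpow_closed)
    also have "(\<sigma> ^^ (a * x)) ((\<sigma> ^^ i) v) = (\<sigma> ^^ ((i + g) + b * y)) v"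
      by (simp add: xy ac_simps flip: funpow_add comp_apply[of "\<sigma> ^^ _"])
    also have "\<dots> = (\<sigma> ^^ (i + g)) v"
      using funpow_mod[of "(i + g) + b * y" v] funpow_mod[of "i + g" v] by (simp flip: b_def)
    finally show ?thesis .
  qed
  have steps: "(\<sigma> ^^ (i + g * j)) v \<in> M" if "(\<sigma> ^^ i) v \<in> M" for i j
    using step[of "i + g * _"] that by (induction j) (simp_all add: algebra_simps)
  show ?thesis
  proof
    assume i: "(\<sigma> ^^ i) v \<in> M"
    have g: "g dvd b" by (simp add: g_def b_def)
    \<comment> \<open>Closure only allows forward steps of length \<open>g\<close>, so
      \<open>i mod g\<close> is reached from \<open>i\<close> by going round \<open>i\<close> times;
      \<open>le\<close> keeps the difference from being truncated.\<close>
    have le: "i div g * g \<le> i * b"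
      using div_times_less_eq_dividend[of i g] mult_le_mono2[of 1 b i] b by linarith
    have "g dvd i * b - i div g * g" using g by (simp add: dvd_diff_nat)
    then obtain j where j: "i * b - i div g * g = g * j" by blast
    have "i + g * j = i mod g + i * b"
      using le j div_mult_mod_eq[of i g] by linarith
    hence "(\<sigma> ^^ (i + g * j)) v = (\<sigma> ^^ (i mod g)) v"
      using funpow_mod[of "i mod g + i * b" v] funpow_mod[of "i mod g" v] by (simp flip: b_def)
    thus "(\<sigma> ^^ (i mod g)) v \<in> M" using steps[OF i, of j] by simp
  next
    assume "(\<sigma> ^^ (i mod g)) v \<in> M"
    from steps[OF this, of "i div g"] show "(\<sigma> ^^ i) v \<in> M" by simp
  qed
qed

text \<open>Each residue class modulo \<open>g\<close> meets a cycle of length \<open>b\<close> in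
  \<open>b div g\<close> points, which is \<open>alpha a b\<close>.\<close>

lemma card_closed_subset_orbit:
  fixes v a
  defines "g \<equiv> gcd a (card (orbit \<sigma> v))"
  assumes "a > 0" "M \<subseteq> orbit \<sigma> v" "\<forall>x\<in>M. (\<sigma> ^^ a) x \<in> M"
  shows "card M = alpha a (card (orbit \<sigma> v)) * card {j. j < g \<and> (\<sigma> ^^ j) v \<in> M}"
proof -
  define b where "b = card (orbit \<sigma> v)"
  have g: "g > 0" "g dvd b" using assms by (auto simp: g_def b_def)
  have "card M = card {i. i < b \<and> (\<sigma> ^^ i) v \<in> M}"
    using card_Int_orbit[of v M] assms by (simp add: b_def Int_absorb2)
  also have "\<dots> = card {i. i < b \<and> (\<sigma> ^^ (i mod g)) v \<in> M}"
    using closed_subset_orbit_periodic[OF assms(2-4)] by (simp add: g_def)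
  also have "\<dots> = (b div g) * card {j. j < g \<and> (\<sigma> ^^ j) v \<in> M}"
    by (rule card_periodic[OF g])
  finally show ?thesis by (simp add: b_def alpha_def g_def)
qed

lemma alpha_pos: "0 < alpha a (card (orbit \<sigma> v))"
  using card_orbit_pos[of v] by (simp add: alpha_def div_greater_zero_iff gcd_le2_nat)

text \<open>A closed set is a choice of residue classes modulo the gcd, and \<open>k\<close> classes
  make up \<open>k * alpha\<close> points. This is the origin of the binomials in
  \<open>weight\<close>.\<close>

lemma card_closed_subsets_orbit:
  assumes "a > 0"
  shows "card {M. M \<subseteq> orbit \<sigma> v \<and> (\<forall>x\<in>M. (\<sigma> ^^ a) x \<in> M)
              \<and> card M = k * alpha a (card (orbit \<sigma> v))}
         = gcd a (card (orbit \<sigma> v)) choose k"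
proof -
  define b g where "b = card (orbit \<sigma> v)" and "g = gcd a b"
  have b: "b > 0" by (simp add: b_def card_orbit_pos)
  have g: "g > 0" "g dvd b" "g dvd a" "g \<le> b" using b by (auto simp: g_def gcd_le2_nat)
  define f where "f = (\<lambda>i. (\<sigma> ^^ i) v)"
  define lift where "lift T = f ` {i. i mod g \<in> T}" for T
  have f_eq: "i mod g = j mod g" if "f i = f j" for i j
  proof -
    have "f (i mod b) = f (j mod b)" using that by (simp add: f_def b_def funpow_mod)
    hence "i mod b = j mod b"
      using inj_onD[OF bij_betw_imp_inj_on[OF bij_betw_funpow[of v]], of "i mod b" "j mod b"] b
      by (simp add: f_def b_def)
    thus ?thesis using g(2) by (metis mod_mod_cancel)
  qed
  have lift_mem: "f i \<in> lift T \<longleftrightarrow> i mod g \<in> T" for i T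
  proof
    assume "f i \<in> lift T"
    then obtain j where "f i = f j" "j mod g \<in> T" unfolding lift_def by blast
    thus "i mod g \<in> T" using f_eq[of i j] by simp
  qed (auto simp: lift_def)
  have lift_closed: "lift T \<subseteq> orbit \<sigma> v \<and> (\<forall>x\<in>lift T. (\<sigma> ^^ a) x \<in> lift T)" for T
  proof -
    have "(\<sigma> ^^ a) (f i) = f (a + i)" for i by (simp add: f_def funpow_add)
    moreover have "(a + i) mod g = i mod g" for i
      using g(3) by (auto elim: dvdE)
    ultimately have "(\<sigma> ^^ a) (f i) \<in> lift T" if "i mod g \<in> T" for i
      using that by (simp add: lift_mem)
    moreover have "f i \<in> orbit \<sigma> v" for i
      unfolding f_def by (rule funpow_in_orbit_self)
    ultimately show ?thesis by (auto simp: lift_def)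
  qed
  have unlift: "lift {j. j < g \<and> f j \<in> M} = M" and card_M: "card M = (b div g) * card {j. j < g \<and> f j \<in> M}"
    if "M \<subseteq> orbit \<sigma> v" "\<forall>x\<in>M. (\<sigma> ^^ a) x \<in> M" for M
  proof -
    have "x \<in> lift {j. j < g \<and> f j \<in> M} \<longleftrightarrow> x \<in> M" if "x \<in> orbit \<sigma> v" for x
    proof -
      obtain i where i: "x = f i" using \<open>x \<in> orbit \<sigma> v\<close> by (auto simp: orbit_funpow f_def)
      have "f i \<in> M \<longleftrightarrow> f (i mod g) \<in> M"
        using closed_subset_orbit_periodic[OF assms \<open>M \<subseteq> orbit \<sigma> v\<close> \<open>\<forall>x\<in>M. (\<sigma> ^^ a) x \<in> M\<close>]
        unfolding f_def g_def b_def .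
      thus ?thesis using g(1) by (simp only: i lift_mem mem_Collect_eq) simp
    qed
    thus "lift {j. j < g \<and> f j \<in> M} = M" using that lift_closed by blast
    show "card M = (b div g) * card {j. j < g \<and> f j \<in> M}"
      using card_closed_subset_orbit[OF assms that] by (simp add: f_def b_def g_def alpha_def)
  qed
  have restrict: "{j. j < g \<and> f j \<in> lift T} = T" if "T \<subseteq> {..<g}" for T
    using that by (auto simp: lift_mem)
  have card_iff: "card M = k * alpha a b \<longleftrightarrow> card {j. j < g \<and> f j \<in> M} = k"
    if "M \<subseteq> orbit \<sigma> v" "\<forall>x\<in>M. (\<sigma> ^^ a) x \<in> M" for M
    using card_M[OF that] g b by (auto simp: alpha_def g_def[symmetric] div_greater_zero_iff)
  have "bij_betw (\<lambda>M. {j. j < g \<and> f j \<in> M})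
      {M. M \<subseteq> orbit \<sigma> v \<and> (\<forall>x\<in>M. (\<sigma> ^^ a) x \<in> M) \<and> card M = k * alpha a b}
      {T. T \<subseteq> {..<g} \<and> card T = k}"
  proof (rule bij_betw_byWitness[where f' = lift])
    show "lift ` {T. T \<subseteq> {..<g} \<and> card T = k}
        \<subseteq> {M. M \<subseteq> orbit \<sigma> v \<and> (\<forall>x\<in>M. (\<sigma> ^^ a) x \<in> M) \<and> card M = k * alpha a b}"
      using lift_closed card_iff restrict by auto
  qed (use unlift restrict card_iff in auto)
  thus ?thesis by (simp add: bij_betw_same_card n_subsets b_def g_def)
qed

text \<open>With \<open>c\<close> as base point, \<open>\<sigma> ^^ i\<close> takes the point at
  offset \<open>j\<close> to \<open>c\<close> exactly if \<open>i = - j\<close> modulo the length.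
  The condition therefore says that the offsets are closed under negation; deleting \<open>c\<close>
  removes offset 0.\<close>

lemma card_symmetric_subsets_orbit:
  "card {M. M \<subseteq> orbit \<sigma> c - {c} \<and> (\<forall>x\<in>M. \<forall>i. (\<sigma> ^^ i) x = c \<longrightarrow> (\<sigma> ^^ i) c \<in> M) \<and> card M = u}
   = I_coeff (card (orbit \<sigma> c)) u"
proof -
  define a where "a = card (orbit \<sigma> c)"
  have a: "a \<ge> 1" using card_orbit_pos[of c] by (simp add: a_def)
  define f where "f = (\<lambda>i. (\<sigma> ^^ i) c)"
  have bij: "bij_betw f {..<a} (orbit \<sigma> c)" using bij_betw_funpow[of c] by (simp add: f_def a_def)
  have f0: "f 0 = c" by (simp add: f_def)
  have f_mod: "f (i mod a) = f i" for i using funpow_mod by (simp add: f_def a_def)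
  have bij': "bij_betw f {1..<a} (orbit \<sigma> c - {c})"
  proof -
    have "bij_betw f ({..<a} - {0}) (orbit \<sigma> c - {f 0})"
      using bij a by (intro bij_betw_DiffI) (auto simp: bij_betw_def)
    moreover have "{..<a} - {0} = {1..<a}" by auto
    ultimately show ?thesis by (simp add: f0)
  qed
  have closed_iff: "(\<forall>x\<in>f ` S. \<forall>i. (\<sigma> ^^ i) x = c \<longrightarrow> f i \<in> f ` S) \<longleftrightarrow> (\<forall>j\<in>S. a - j \<in> S)"
    if S: "S \<subseteq> {1..<a}" for S
  proof -
    have hits: "(\<sigma> ^^ i) (f j) = c \<longleftrightarrow> a dvd i + j" for i j
      using funpow_eq_self_iff[of "i + j" c] by (simp add: f_def a_def funpow_add)
    have mem: "f j \<in> f ` S \<longleftrightarrow> j \<in> S" if "j < a" for j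
    proof (rule inj_on_image_mem_iff)
      show "inj_on f {..<a}" by (rule bij_betw_imp_inj_on[OF bij])
    qed (use S that in auto)
    show ?thesis
    proof
      assume *: "\<forall>x\<in>f ` S. \<forall>i. (\<sigma> ^^ i) x = c \<longrightarrow> f i \<in> f ` S"
      show "\<forall>j\<in>S. a - j \<in> S"
      proof
        fix j assume j: "j \<in> S"
        hence "f (a - j) \<in> f ` S" using * hits[of "a - j" j] S by auto
        thus "a - j \<in> S" using mem[of "a - j"] j S by auto
      qed
    next
      assume *: "\<forall>j\<in>S. a - j \<in> S"
      show "\<forall>x\<in>f ` S. \<forall>i. (\<sigma> ^^ i) x = c \<longrightarrow> f i \<in> f ` S"
      proof (intro ballI allI impI)
        fix x i assume "x \<in> f ` S" "(\<sigma> ^^ i) x = c"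
        then obtain j where j: "j \<in> S" "a dvd i + j" using hits by auto
        hence "1 \<le> j" "j < a" using S by auto
        \<comment> \<open>With \<open>i\<close> reduced, the sum lies strictly between 0 and
          \<open>2 * a\<close>, so divisibility leaves \<open>a\<close> as its only value.\<close>
        have "a dvd i mod a + j" using j(2) by (simp add: dvd_eq_mod_eq_0 mod_simps)
        then obtain q where q: "i mod a + j = a * q" by blast
        have "i mod a < a" using a by simp
        hence "a * q < a * 2" "a * q > 0" using q \<open>1 \<le> j\<close> \<open>j < a\<close> by linarith+
        hence "q = 1" by simp
        hence "i mod a = a - j" using q by simp
        thus "f i \<in> f ` S" using * j f_mod[of i] by (metis image_eqI)
      qed
    qed
  qed
  have "bij_betw (image f) {S. S \<subseteq> {1..<a} \<and> (\<forall>j\<in>S. a - j \<in> S) \<and> card S = u}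
      {M. M \<subseteq> orbit \<sigma> c - {c} \<and> (\<forall>x\<in>M. \<forall>i. (\<sigma> ^^ i) x = c \<longrightarrow> f i \<in> M) \<and> card M = u}"
  proof -
    have "bij_betw (image f) (Pow {1..<a}) (Pow (orbit \<sigma> c - {c}))" by (rule bij_betw_Pow[OF bij'])
    hence inj: "inj_on (image f) (Pow {1..<a})" and im: "image f ` Pow {1..<a} = Pow (orbit \<sigma> c - {c})"
      by (auto simp: bij_betw_def)
    have card: "card (f ` S) = card S" if "S \<subseteq> {1..<a}" for S
      using bij' that by (meson bij_betw_def card_image inj_on_subset)
    show ?thesis
      unfolding bij_betw_def
    proof
      show "inj_on (image f) {S. S \<subseteq> {1..<a} \<and> (\<forall>j\<in>S. a - j \<in> S) \<and> card S = u}"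
        using inj by (rule inj_on_subset) auto
      show "image f ` {S. S \<subseteq> {1..<a} \<and> (\<forall>j\<in>S. a - j \<in> S) \<and> card S = u}
        = {M. M \<subseteq> orbit \<sigma> c - {c} \<and> (\<forall>x\<in>M. \<forall>i. (\<sigma> ^^ i) x = c \<longrightarrow> f i \<in> M) \<and> card M = u}" (is "?L = ?R")
      proof
        show "?L \<subseteq> ?R"
        proof clarify
          fix S assume S: "S \<subseteq> {1..<a}" "\<forall>j\<in>S. a - j \<in> S" "u = card S"
          have "f ` S \<subseteq> orbit \<sigma> c - {c}" using im S(1) by blast
          thus "f ` S \<subseteq> orbit \<sigma> c - {c} \<and> (\<forall>x\<in>f ` S. \<forall>i. (\<sigma> ^^ i) x = c \<longrightarrow> f i \<in> f ` S) \<and> card (f ` S) = card S"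
            using closed_iff[OF S(1)] S card by blast
        qed
        show "?R \<subseteq> ?L"
        proof
          fix M assume M: "M \<in> ?R"
          hence "M \<in> Pow (orbit \<sigma> c - {c})" by blast
          then obtain S where S: "S \<subseteq> {1..<a}" "M = f ` S" unfolding im[symmetric] by blast
          hence "\<forall>j\<in>S. a - j \<in> S" "card S = u"
            using M closed_iff[OF S(1)] card[OF S(1)] by auto
          thus "M \<in> ?L" using S by blast
        qed
      qed
    qed
  qed
  hence "card {M. M \<subseteq> orbit \<sigma> c - {c} \<and> (\<forall>x\<in>M. \<forall>i. (\<sigma> ^^ i) x = c \<longrightarrow> f i \<in> M) \<and> card M = u}
      = I_coeff a u"
    using card_symmetric_subsets[OF a] by (simp add: bij_betw_same_card[symmetric])
  thus ?thesis by (simp add: f_def a_def)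
qed

end

section \<open>Removing the pivot cycle\<close>

definition neighbours :: "'v set set \<Rightarrow> 'v \<Rightarrow> 'v set" where
  "neighbours E v = {w. {v, w} \<in> E}"

context finite_perm
begin

text \<open>Only forward closure is demanded, which is easier to check; for
  \<open>U \<subseteq> V\<close> finiteness upgrades it to the equality in
  \<open>invariant_completions\<close>. The set \<open>U\<close> is a parameter because the edges
  left over live on \<open>V - C\<close> while \<open>\<sigma>\<close> acts on all of
  \<open>V\<close>.\<close>

definition invariant_edges :: "'v set \<Rightarrow> 'v set set \<Rightarrow> bool" where
  "invariant_edges U E \<longleftrightarrow> (\<forall>e\<in>E. e \<subseteq> U \<and> card e = 2) \<and> (\<forall>e\<in>E. \<sigma> ` e \<in> E)"

lemma surj_funpow: "surj (\<sigma> ^^ i)"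
  using permutes_surj[OF permutes] by (rule surj_fn)

lemma card_funpow_image: "card ((\<sigma> ^^ i) ` S) = card S"
  by (rule card_image[OF inj_on_subset[OF inj_funpow subset_UNIV]])

lemma funpow_image_orbit: "(\<sigma> ^^ i) ` orbit \<sigma> v = orbit \<sigma> v"
proof (rule card_subset_eq[OF finite_orbit_V])
  show "(\<sigma> ^^ i) ` orbit \<sigma> v \<subseteq> orbit \<sigma> v" by (auto intro: funpow_in_orbit)
  show "card ((\<sigma> ^^ i) ` orbit \<sigma> v) = card (orbit \<sigma> v)"
    by (rule card_funpow_image)
qed

text \<open>The induced map on edges is injective, and an injective map of a finite set into itself
  is onto.\<close>

lemma invariant_edges_image:
  assumes "invariant_edges U E" "U \<subseteq> V"
  shows "(\<lambda>e. \<sigma> ` e) ` E = E"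
proof (rule card_subset_eq)
  have "E \<subseteq> Pow V" using assms by (auto simp: invariant_edges_def)
  thus "finite E" using finite_V by (meson finite_Pow_iff finite_subset)
  show "(\<lambda>e. \<sigma> ` e) ` E \<subseteq> E" using assms by (auto simp: invariant_edges_def)
  show "card ((\<lambda>e. \<sigma> ` e) ` E) = card E"
    by (intro card_image inj_onI) (simp add: inj_image_eq_iff[OF permutes_inj[OF permutes]])
qed

lemma invariant_edges_funpow_iff:
  assumes "invariant_edges U E" "U \<subseteq> V"
  shows "(\<sigma> ^^ i) ` e \<in> E \<longleftrightarrow> e \<in> E"
proof -
  have step: "\<sigma> ` e \<in> E \<longleftrightarrow> e \<in> E" for e
  proof
    assume "\<sigma> ` e \<in> E"
    then obtain e' where "e' \<in> E" "\<sigma> ` e = \<sigma> ` e'"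
      using invariant_edges_image[OF assms] by blast
    thus "e \<in> E" by (simp add: inj_image_eq_iff[OF permutes_inj[OF permutes]])
  qed (use assms in \<open>auto simp: invariant_edges_def\<close>)
  show ?thesis
  proof (induction i)
    case (Suc i)
    have "(\<sigma> ^^ Suc i) ` e = \<sigma> ` ((\<sigma> ^^ i) ` e)" by auto
    thus ?case using Suc step by metis
  qed simp
qed

lemma neighbours_funpow:
  assumes "invariant_edges U E" "U \<subseteq> V"
  shows "neighbours E ((\<sigma> ^^ i) v) = (\<sigma> ^^ i) ` neighbours E v"
proof -
  have "(\<sigma> ^^ i) x \<in> neighbours E ((\<sigma> ^^ i) v) \<longleftrightarrow> x \<in> neighbours E v" for x
    using invariant_edges_funpow_iff[OF assms, of i "{v, x}"] by (simp add: neighbours_def)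
  hence "neighbours E v = (\<sigma> ^^ i) -` neighbours E ((\<sigma> ^^ i) v)" by auto
  thus ?thesis by (simp only: surj_image_vimage_eq[OF surj_funpow])
qed

lemma neighbours_sym: "w \<in> neighbours E v \<longleftrightarrow> v \<in> neighbours E w"
  by (simp add: neighbours_def insert_commute)

lemma neighbours_subset:
  assumes "invariant_edges U E"
  shows "neighbours E v \<subseteq> U - {v}"
proof
  fix w assume w: "w \<in> neighbours E v"
  hence "{v, w} \<subseteq> U" "card {v, w} = 2" using assms by (auto simp: invariant_edges_def neighbours_def)
  thus "w \<in> U - {v}" by (cases "v = w") auto
qed

lemma card_edges_at:
  assumes "invariant_edges U E"
  shows "card {e \<in> E. v \<in> e} = card (neighbours E v)"
proof -
  have "{e \<in> E. v \<in> e} = (\<lambda>w. {v, w}) ` neighbours E v"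
  proof
    show "{e \<in> E. v \<in> e} \<subseteq> (\<lambda>w. {v, w}) ` neighbours E v"
    proof
      fix e assume "e \<in> {e \<in> E. v \<in> e}"
      hence e: "e \<in> E" "v \<in> e" "card e = 2" using assms by (auto simp: invariant_edges_def)
      then obtain w where "e = {v, w}" by (auto simp: card_2_iff)
      thus "e \<in> (\<lambda>w. {v, w}) ` neighbours E v" using e by (auto simp: neighbours_def)
    qed
  qed (auto simp: neighbours_def)
  moreover have "inj_on (\<lambda>w. {v, w}) (neighbours E v)"
    by (auto simp: inj_on_def doubleton_eq_iff)
  ultimately show ?thesis by (simp add: card_image)
qed

lemma invariant_completions_eq:
  assumes "U \<subseteq> V"
  shows "invariant_completions U \<sigma> \<rho>
       = {E. invariant_edges U E \<and> (\<forall>v\<in>U. card (neighbours E v) = \<rho> v)}"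
proof -
  have "E \<subseteq> {e. e \<subseteq> U \<and> card e = 2} \<and> (\<lambda>e. \<sigma> ` e) ` E = E \<longleftrightarrow> invariant_edges U E" for E
    using invariant_edges_image[OF _ assms, of E] by (auto simp: invariant_edges_def)
  moreover have "(\<forall>v\<in>U. card {e \<in> E. v \<in> e} = \<rho> v) \<longleftrightarrow> (\<forall>v\<in>U. card (neighbours E v) = \<rho> v)"
    if "invariant_edges U E" for E
    using card_edges_at[OF that] by simp
  ultimately show ?thesis
    unfolding invariant_completions_def conj_assoc[symmetric] by (intro Collect_cong) (simp cong: conj_cong)
qed

text \<open>Double counting of the edges between two cycles.\<close>

lemma card_neighbours_Int_orbit:
  assumes "invariant_edges U E" "U \<subseteq> V"
  shows "card (neighbours E x \<inter> orbit \<sigma> y) * card (orbit \<sigma> x)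
       = card (neighbours E y \<inter> orbit \<sigma> x) * card (orbit \<sigma> y)"
proof -
  \<comment> \<open>\<open>\<sigma> ^^ i\<close> preserves the edges and maps the cycle of
    \<open>y\<close> to itself, so all vertices on the cycle of \<open>x\<close> have equally many
    neighbours there.\<close>
  have const: "card (neighbours E u \<inter> orbit \<sigma> y) = card (neighbours E x \<inter> orbit \<sigma> y)"
    if u: "u \<in> orbit \<sigma> x" for u x y
  proof -
    obtain i where i: "u = (\<sigma> ^^ i) x" using u by (auto simp: orbit_funpow)
    have "neighbours E u \<inter> orbit \<sigma> y = (\<sigma> ^^ i) ` (neighbours E x \<inter> orbit \<sigma> y)"
      using inj_funpow by (simp add: i neighbours_funpow[OF assms] image_Int funpow_image_orbit)
    also have "card \<dots> = card (neighbours E x \<inter> orbit \<sigma> y)"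
      by (rule card_funpow_image)
    finally show ?thesis .
  qed
  have sum: "(\<Sum>u\<in>orbit \<sigma> x. card (neighbours E u \<inter> orbit \<sigma> y))
      = card (SIGMA u:orbit \<sigma> x. neighbours E u \<inter> orbit \<sigma> y)" for x y
    using finite_orbit_V by simp
  have "(SIGMA u:orbit \<sigma> y. neighbours E u \<inter> orbit \<sigma> x)
      = prod.swap ` (SIGMA u:orbit \<sigma> x. neighbours E u \<inter> orbit \<sigma> y)"
    using neighbours_sym[of _ E] by (auto simp: image_iff)
  hence "card (SIGMA u:orbit \<sigma> x. neighbours E u \<inter> orbit \<sigma> y)
      = card (SIGMA u:orbit \<sigma> y. neighbours E u \<inter> orbit \<sigma> x)"
    by (simp add: card_image)
  thus ?thesis unfolding sum[symmetric] by (simp add: const mult.commute)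
qed

end

section \<open>Edges that meet the pivot cycle\<close>

locale pivot = finite_perm V \<sigma> for V :: "'v set" and \<sigma> +
  fixes c :: 'v
  assumes c_in_V: "c \<in> V"
begin

abbreviation C :: "'v set" where "C \<equiv> orbit \<sigma> c"

text \<open>The sets that occur as the neighbourhood of the pivot vertex \<open>c\<close> in an invariant edge set,
  and the set of edges meeting the pivot cycle that such a neighbourhood generates.\<close>

definition admissible :: "'v set \<Rightarrow> bool" where
  "admissible N \<longleftrightarrow> N \<subseteq> V - {c} \<and> (\<forall>x\<in>N. (\<sigma> ^^ card C) x \<in> N)
     \<and> (\<forall>x\<in>N. \<forall>i. (\<sigma> ^^ i) x = c \<longrightarrow> (\<sigma> ^^ i) c \<in> N)"

definition star :: "'v set \<Rightarrow> 'v set set" where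
  "star N = {(\<sigma> ^^ i) ` {c, x} | i x. x \<in> N}"

text \<open>\<open>\<sigma> ^^ card C\<close> fixes \<open>c\<close> and hence preserves its
  neighbourhood. A power that takes a neighbour \<open>x\<close> to \<open>c\<close> takes the edge
  \<open>{c, x}\<close> to one that joins \<open>c\<close> to the image of \<open>c\<close>; this is
  the source of the last clause of \<open>admissible\<close>.\<close>

lemma admissible_neighbours:
  assumes "invariant_edges V E"
  shows "admissible (neighbours E c)"
proof -
  have *: "{(\<sigma> ^^ i) c, (\<sigma> ^^ i) x} \<in> E" if "x \<in> neighbours E c" for i x
    using invariant_edges_funpow_iff[OF assms subset_refl, of i "{c, x}"] that
    by (simp add: neighbours_def)
  have "(\<sigma> ^^ card C) c = c" by (simp add: funpow_eq_self_iff)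
  thus ?thesis
    using neighbours_subset[OF assms, of c] *[of _ "card C"] * 
    by (auto simp: admissible_def neighbours_def insert_commute)
qed

lemma invariant_edges_star:
  assumes "admissible N"
  shows "invariant_edges V (star N)"
proof -
  have "(\<sigma> ^^ i) ` {c, x} \<subseteq> V \<and> card ((\<sigma> ^^ i) ` {c, x}) = 2" if "x \<in> N" for i x
  proof -
    have x: "x \<in> V" "x \<noteq> c" using assms that by (auto simp: admissible_def)
    have "(\<sigma> ^^ i) v \<in> V" if "v \<in> V" for v
      using orbit_subset_V[OF that] funpow_in_orbit_self by blast
    moreover have "card ((\<sigma> ^^ i) ` {c, x}) = card {c, x}"
      by (rule card_funpow_image)
    ultimately show ?thesis using x c_in_V by auto
  qed
  moreover have "\<sigma> ` ((\<sigma> ^^ i) ` {c, x}) = (\<sigma> ^^ Suc i) ` {c, x}" for i x by auto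
  ultimately show ?thesis unfolding invariant_edges_def star_def by blast
qed

lemma star_meets: "e \<in> star N \<Longrightarrow> e \<inter> C \<noteq> {}"
  unfolding star_def using funpow_in_orbit_self by blast

text \<open>A star edge at \<open>c\<close> is a translate of some \<open>{c, x}\<close> with one
  end moved onto \<open>c\<close>. If that end is \<open>c\<close>, the exponent is a multiple of
  \<open>card C\<close>; if it is \<open>x\<close>, the reversal clause applies. So the star creates
  no further neighbours of \<open>c\<close>.\<close>

lemma neighbours_star:
  assumes "admissible N"
  shows "neighbours (star N) c = N"
proof
  show "N \<subseteq> neighbours (star N) c"
  proof
    fix x assume "x \<in> N"
    moreover have "{c, x} = (\<sigma> ^^ 0) ` {c, x}" by simp
    ultimately show "x \<in> neighbours (star N) c" unfolding neighbours_def star_def by blast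
  qed
  show "neighbours (star N) c \<subseteq> N"
  proof
    fix w assume "w \<in> neighbours (star N) c"
    then obtain i x where x: "x \<in> N" and eq: "{c, w} = {(\<sigma> ^^ i) c, (\<sigma> ^^ i) x}"
      by (auto simp: neighbours_def star_def)
    from eq consider "(\<sigma> ^^ i) c = c" "w = (\<sigma> ^^ i) x" | "(\<sigma> ^^ i) x = c" "w = (\<sigma> ^^ i) c"
      by (auto simp: doubleton_eq_iff)
    thus "w \<in> N"
    proof cases
      case 1
      then obtain j where "i = card C * j" by (auto simp: funpow_eq_self_iff)
      thus ?thesis using 1 x assms funpow_closed[of N "card C" x j] by (simp add: admissible_def)
    next
      case 2
      thus ?thesis using x assms by (auto simp: admissible_def)
    qed
  qed
qed

text \<open>An edge that contains \<open>(\<sigma> ^^ i) c\<close> is pulled back along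
  \<open>\<sigma> ^^ i\<close> to an edge at \<open>c\<close>.\<close>

lemma star_neighbours:
  assumes "invariant_edges V E"
  shows "star (neighbours E c) = {e \<in> E. e \<inter> C \<noteq> {}}"
proof
  show "star (neighbours E c) \<subseteq> {e \<in> E. e \<inter> C \<noteq> {}}"
    using star_meets invariant_edges_funpow_iff[OF assms subset_refl]
    by (auto simp: star_def neighbours_def simp del: image_insert)
  show "{e \<in> E. e \<inter> C \<noteq> {}} \<subseteq> star (neighbours E c)"
  proof
    fix e assume e: "e \<in> {e \<in> E. e \<inter> C \<noteq> {}}"
    then obtain i where i: "(\<sigma> ^^ i) c \<in> e" by (auto simp: orbit_funpow)
    have "card e = 2" using assms e by (auto simp: invariant_edges_def)
    then obtain w where w: "e = {(\<sigma> ^^ i) c, w}" using i by (auto simp: card_2_iff)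
    obtain x where x: "w = (\<sigma> ^^ i) x" using surj_funpow by blast
    have "e = (\<sigma> ^^ i) ` {c, x}" using w x by simp
    moreover from this have "{c, x} \<in> E"
      using e invariant_edges_funpow_iff[OF assms subset_refl, of i "{c, x}"] by blast
    ultimately show "e \<in> star (neighbours E c)" unfolding star_def neighbours_def by blast
  qed
qed

definition demand :: "'v set \<Rightarrow> 'v \<Rightarrow> nat" where
  "demand N w = card (neighbours (star N) w)"

lemma demand_pivot:
  assumes "admissible N" "v \<in> C"
  shows "demand N v = card N"
proof -
  obtain i where i: "v = (\<sigma> ^^ i) c" using assms by (auto simp: orbit_funpow)
  have "demand N v = card ((\<sigma> ^^ i) ` N)"
    using assms by (simp add: i demand_def neighbours_funpow[OF invariant_edges_star] neighbours_star)
  also have "\<dots> = card N" by (rule card_funpow_image)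
  finally show ?thesis .
qed

text \<open>All star neighbours of a vertex outside \<open>C\<close> lie on \<open>C\<close>, so
  double counting between the two cycles relates its degree to the trace of
  \<open>N\<close>.\<close>

lemma demand_other:
  assumes "admissible N" "w \<in> V - C"
  shows "demand N w * card (orbit \<sigma> w) = card C * card (N \<inter> orbit \<sigma> w)"
proof -
  have "neighbours (star N) w \<inter> C = neighbours (star N) w"
    using star_meets[of _ N] assms by (fastforce simp: neighbours_def)
  thus ?thesis
    using card_neighbours_Int_orbit[OF invariant_edges_star[OF assms(1)] subset_refl, of w c]
    by (simp add: demand_def neighbours_star[OF assms(1)] mult.commute)
qed

text \<open>Star edges meet \<open>C\<close> and edges of \<open>E'\<close> avoid it, so the two
  kinds never coincide and their degrees add.\<close>

lemma
  assumes "invariant_edges (V - C) E'"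
  shows neighbours_Un_pivot: "v \<in> C \<Longrightarrow> neighbours (star N \<union> E') v = neighbours (star N) v"
    and card_neighbours_Un:
      "admissible N \<Longrightarrow> card (neighbours (star N \<union> E') v) = demand N v + card (neighbours E' v)"
proof -
  show "neighbours (star N \<union> E') v = neighbours (star N) v" if "v \<in> C"
    using that assms by (auto simp: neighbours_def invariant_edges_def)
  assume adm: "admissible N"
  have "neighbours (star N \<union> E') v = neighbours (star N) v \<union> neighbours E' v"
    by (auto simp: neighbours_def)
  moreover have "star N \<inter> E' = {}"
    using star_meets[of _ N] assms by (fastforce simp: invariant_edges_def)
  hence "neighbours (star N) v \<inter> neighbours E' v = {}" by (auto simp: neighbours_def)
  moreover have "finite (neighbours (star N) v)" "finite (neighbours E' v)"
    using neighbours_subset[OF invariant_edges_star[OF adm]] neighbours_subset[OF assms] finite_V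
    by (meson finite_Diff finite_subset)+
  ultimately show "card (neighbours (star N \<union> E') v) = demand N v + card (neighbours E' v)"
    by (simp add: demand_def card_Un_disjoint)
qed

lemma invariant_edges_rest:
  assumes "invariant_edges V E"
  shows "invariant_edges (V - C) {e \<in> E. e \<inter> C = {}}"
    and "star (neighbours E c) \<union> {e \<in> E. e \<inter> C = {}} = E"
proof -
  show "invariant_edges (V - C) {e \<in> E. e \<inter> C = {}}"
    unfolding invariant_edges_def
  proof (intro conjI ballI)
    fix e assume e: "e \<in> {e \<in> E. e \<inter> C = {}}"
    show "e \<subseteq> V - C" "card e = 2" using e assms by (auto simp: invariant_edges_def)
    have "\<sigma> ` e \<inter> \<sigma> ` C = {}"
      using e by (simp add: image_Int[OF permutes_inj[OF permutes], symmetric])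
    moreover have "\<sigma> ` C = C" using funpow_image_orbit[of 1 c] by simp
    ultimately show "\<sigma> ` e \<in> {e \<in> E. e \<inter> C = {}}"
      using e assms by (auto simp: invariant_edges_def)
  qed
  show "star (neighbours E c) \<union> {e \<in> E. e \<inter> C = {}} = E"
    using star_neighbours[OF assms] by auto
qed

text \<open>An invariant edge set is the star of the neighbourhood of \<open>c\<close> together with
  the edges that avoid \<open>C\<close>, and compatible pieces can be glued back.
  \<open>card N = r\<close> settles the degrees on \<open>C\<close>;
  \<open>demand N w \<le> \<rho> w\<close> keeps the truncated difference exact elsewhere.\<close>

lemma card_invariant_completions_pivot:
  assumes \<rho>: "\<And>v. v \<in> C \<Longrightarrow> \<rho> v = r"
  shows "card (invariant_completions V \<sigma> \<rho>)
       = (\<Sum>N | admissible N \<and> card N = r \<and> (\<forall>w\<in>V - C. demand N w \<le> \<rho> w).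
            card (invariant_completions (V - C) \<sigma> (\<lambda>w. \<rho> w - demand N w)))"
proof -
  define G where "G = {N. admissible N \<and> card N = r \<and> (\<forall>w\<in>V - C. demand N w \<le> \<rho> w)}"
  define R where "R N = invariant_completions (V - C) \<sigma> (\<lambda>w. \<rho> w - demand N w)" for N
  have R: "E' \<in> R N \<longleftrightarrow> invariant_edges (V - C) E' \<and> (\<forall>w\<in>V - C. card (neighbours E' w) = \<rho> w - demand N w)" for E' N
    using invariant_completions_eq[of "V - C"] by (simp add: R_def)
  have IC: "E \<in> invariant_completions V \<sigma> \<rho> \<longleftrightarrow> invariant_edges V E \<and> (\<forall>w\<in>V. card (neighbours E w) = \<rho> w)" for E
    using invariant_completions_eq[OF subset_refl] by simp
  have "bij_betw (\<lambda>E. (neighbours E c, {e \<in> E. e \<inter> C = {}})) (invariant_completions V \<sigma> \<rho>) (SIGMA N:G. R N)"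
  proof (rule bij_betw_byWitness[where f' = "\<lambda>(N, E'). star N \<union> E'"])
    show "\<forall>E\<in>invariant_completions V \<sigma> \<rho>. (case (neighbours E c, {e \<in> E. e \<inter> C = {}}) of (N, E') \<Rightarrow> star N \<union> E') = E"
      using invariant_edges_rest(2) by (simp add: IC)
    show "\<forall>p\<in>SIGMA N:G. R N. (neighbours (case p of (N, E') \<Rightarrow> star N \<union> E') c,
        {e \<in> (case p of (N, E') \<Rightarrow> star N \<union> E'). e \<inter> C = {}}) = p"
    proof
      fix p assume "p \<in> (SIGMA N:G. R N)"
      then obtain N E' where p: "p = (N, E')" and N: "N \<in> G" and E': "E' \<in> R N" by blast
      have E'_inv: "invariant_edges (V - C) E'" using E' by (simp add: R)
      have "neighbours (star N \<union> E') c = N"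
        using neighbours_Un_pivot[OF E'_inv self_in_orbit] N neighbours_star by (simp add: G_def)
      moreover have "{e \<in> star N \<union> E'. e \<inter> C = {}} = E'"
        using star_meets[of _ N] E'_inv unfolding invariant_edges_def by blast
      ultimately show "(neighbours (case p of (N, E') \<Rightarrow> star N \<union> E') c,
        {e \<in> (case p of (N, E') \<Rightarrow> star N \<union> E'). e \<inter> C = {}}) = p" by (simp add: p)
    qed
    show "(\<lambda>E. (neighbours E c, {e \<in> E. e \<inter> C = {}})) ` invariant_completions V \<sigma> \<rho> \<subseteq> (SIGMA N:G. R N)"
    proof (rule image_subsetI)
      fix E assume E: "E \<in> invariant_completions V \<sigma> \<rho>"
      hence inv: "invariant_edges V E" by (simp add: IC)
      have adm: "admissible (neighbours E c)" by (rule admissible_neighbours[OF inv])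
      have "\<rho> w = demand (neighbours E c) w + card (neighbours {e \<in> E. e \<inter> C = {}} w)" if "w \<in> V" for w
        using card_neighbours_Un[OF invariant_edges_rest(1)[OF inv] adm, of w] that E
        by (simp add: IC invariant_edges_rest(2)[OF inv])
      thus "(neighbours E c, {e \<in> E. e \<inter> C = {}}) \<in> (SIGMA N:G. R N)"
        using E adm c_in_V \<rho>[OF self_in_orbit] invariant_edges_rest(1)[OF inv] by (simp add: G_def R IC)
    qed
    show "(\<lambda>(N, E'). star N \<union> E') ` (SIGMA N:G. R N) \<subseteq> invariant_completions V \<sigma> \<rho>"
    proof clarify
      fix N E' assume N: "N \<in> G" and E': "E' \<in> R N"
      have E'_inv: "invariant_edges (V - C) E'" using E' by (simp add: R)
      have adm: "admissible N" using N by (simp add: G_def)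
      have "invariant_edges V (star N \<union> E')"
        using invariant_edges_star[OF adm] E'_inv unfolding invariant_edges_def by blast
      moreover have "card (neighbours (star N \<union> E') w) = \<rho> w" if w: "w \<in> V" for w
      proof (cases "w \<in> C")
        case True
        thus ?thesis
          using neighbours_Un_pivot[OF E'_inv True] demand_pivot[OF adm True] \<rho>[OF True] N
          by (simp add: demand_def G_def)
      next
        case False
        thus ?thesis using card_neighbours_Un[OF E'_inv adm, of w] w N E' by (simp add: G_def R)
      qed
      ultimately show "star N \<union> E' \<in> invariant_completions V \<sigma> \<rho>" by (simp add: IC)
    qed
  qed
  hence "card (invariant_completions V \<sigma> \<rho>) = card (SIGMA N:G. R N)" by (rule bij_betw_same_card)
  also have "\<dots> = (\<Sum>N\<in>G. card (R N))"
  proof (rule card_SigmaI)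
    have "G \<subseteq> Pow V" by (auto simp: G_def admissible_def)
    thus "finite G" using finite_V by (meson finite_Pow_iff finite_subset)
    have "R N \<subseteq> Pow (Pow V)" for N by (auto simp: R_def invariant_completions_def)
    thus "\<forall>N\<in>G. finite (R N)" using finite_V by (meson finite_Pow_iff finite_subset)
  qed
  finally show ?thesis by (simp add: G_def R_def)
qed

end

section \<open>Neighbourhoods of the pivot vertex by cycle\<close>

lemma sum_card_fibers:
  assumes "finite A" "finite P"
  shows "(\<Sum>p\<in>P. card {x \<in> A. f x = p}) = card {x \<in> A. f x \<in> P}"
proof -
  have "{x \<in> A. f x \<in> P} = (\<Union>p\<in>P. {x \<in> A. f x = p})" by auto
  also have "card \<dots> = (\<Sum>p\<in>P. card {x \<in> A. f x = p})"
    using assms by (intro card_UN_disjoint) auto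
  finally show ?thesis ..
qed

text \<open>With a single class, of type \<open>unit\<close>,
  \<open>card_functions_with_class_counts\<close> exhibits the multinomial coefficient as a number
  of functions, hence as an integer. This makes the \<open>div\<close> in \<open>weight\<close>
  exact.\<close>

lemma prod_fact_dvd_fact_sum:
  fixes \<nu> :: "'k \<Rightarrow> nat"
  assumes "finite B"
  shows "(\<Prod>k\<in>B. fact (\<nu> k) :: nat) dvd fact (\<Sum>k\<in>B. \<nu> k)"
proof -
  let ?A = "{..<\<Sum>k\<in>B. \<nu> k}"
  define n where "n = card {\<kappa> \<in> PiE ?A (\<lambda>_. B). \<forall>p\<in>Sigma {()} (\<lambda>_. B). card {x \<in> ?A. ((), \<kappa> x) = p} = \<nu> (snd p)}"
  have "n * (\<Prod>p\<in>Sigma {()} (\<lambda>_. B). fact (\<nu> (snd p))) = (\<Prod>t\<in>{()}. fact (card {x \<in> ?A. () = t}))"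
    unfolding n_def by (rule card_functions_with_class_counts) (use assms in auto)
  moreover have "(\<Prod>p\<in>Sigma {()} (\<lambda>_. B). fact (\<nu> (snd p))) = (\<Prod>k\<in>B. fact (\<nu> k) :: nat)"
    using assms prod.Sigma[of "{()}" "\<lambda>_. B" "\<lambda>_ k. fact (\<nu> k) :: nat"] by (simp add: case_prod_beta)
  ultimately have "fact (\<Sum>k\<in>B. \<nu> k) = n * (\<Prod>k\<in>B. fact (\<nu> k))" by simp
  thus ?thesis by (rule dvdI[OF trans[OF _ mult.commute]])
qed

text \<open>Both sides are \<open>lcm a b\<close>, the length of an edge orbit between distinct
  cycles of lengths \<open>a\<close> and \<open>b\<close>.\<close>

lemma alpha_beta: "a * alpha a b = b * beta a b"
  by (simp add: alpha_def beta_def) (metis div_mult_swap dvd_div_mult gcd_dvd1 gcd_dvd2 mult.commute)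

text \<open>Clearing the divisions exposes the three limits: the number of edge orbits between the
  cycles, the degree at the pivot, and the degree on the other cycle.\<close>

lemma le_K_max_iff:
  assumes "a > 0" "b > 0"
  shows "k \<le> K_max a r b s \<longleftrightarrow> k \<le> gcd a b \<and> k * alpha a b \<le> r \<and> k * beta a b \<le> s"
proof -
  have "alpha a b > 0" "beta a b > 0"
    using assms by (auto simp: alpha_def beta_def div_greater_zero_iff gcd_le1_nat gcd_le2_nat)
  thus ?thesis by (simp add: K_max_def less_eq_div_iff_mult_less_eq)
qed

section \<open>Classes of the remaining cycles\<close>

locale pivot_realization = pivot V \<sigma> c for V :: "'v set" and \<sigma> c +
  fixes d :: nat and H :: state and \<rho> :: "'v \<Rightarrow> nat"
  assumes realization: "labeled_realization d H V \<sigma> \<rho>"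
    and normalized: "normalized_state d H"
begin

abbreviation a :: nat where "a \<equiv> card C"
abbreviation r :: nat where "r \<equiv> \<rho> c"
abbreviation h :: state where "h \<equiv> remove_pivot H a r"

definition others :: "'v set set" where
  "others = orbit \<sigma> ` (V - C)"

definition val :: "'v set \<Rightarrow> nat" where
  "val D = the_elem (\<rho> ` D)"

definition cls :: "'v set \<Rightarrow> nat \<times> nat" where
  "cls D = (card D, val D)"

lemma \<rho>_range: "v \<in> V \<Longrightarrow> \<rho> v \<in> {1..d}"
  using realization by (auto simp: labeled_realization_def)

lemma \<rho>_orbit: "v \<in> V \<Longrightarrow> w \<in> orbit \<sigma> v \<Longrightarrow> \<rho> w = \<rho> v"
  using realization by (auto simp: labeled_realization_def)

lemma val_orbit: "v \<in> V \<Longrightarrow> val (orbit \<sigma> v) = \<rho> v"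
proof -
  assume "v \<in> V"
  hence "\<rho> ` orbit \<sigma> v = {\<rho> v}" using \<rho>_orbit self_in_orbit by blast
  thus ?thesis by (simp add: val_def)
qed

lemma a_pos: "a > 0" by (rule card_orbit_pos)

lemma others_cases:
  assumes "D \<in> others"
  obtains v where "v \<in> V - C" "D = orbit \<sigma> v"
  using assms by (auto simp: others_def)

lemma orbit_in_others: "v \<in> V - C \<Longrightarrow> orbit \<sigma> v \<in> others"
  by (auto simp: others_def)

lemma finite_others: "finite others"
  using finite_V by (auto simp: others_def)

lemma others_disjoint_C: "D \<in> others \<Longrightarrow> D \<inter> C = {}"
  by (elim others_cases) (use orbit_eq self_in_orbit in blast)

lemma C_notin_others: "C \<notin> others"
  using others_disjoint_C self_in_orbit by blast

lemma others_subset: "D \<in> others \<Longrightarrow> D \<subseteq> V - C"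
  using others_disjoint_C[of D] orbit_subset_V by (auto simp: others_def disjoint_iff)

lemma others_finite_pos: "D \<in> others \<Longrightarrow> finite D \<and> card D > 0"
  using finite_orbit_V card_orbit_pos by (auto elim!: others_cases)

lemma orbits_eq: "orbit \<sigma> ` V = insert C others"
proof
  show "orbit \<sigma> ` V \<subseteq> insert C others" using orbit_eq by (auto simp: others_def)
  show "insert C others \<subseteq> orbit \<sigma> ` V" using c_in_V by (auto simp: others_def)
qed

lemma Union_orbits: "\<Union>(insert C others) = V"
  unfolding orbits_eq[symmetric] using orbit_subset_V self_in_orbit by blast

lemma disjoint_orbits: "pairwise disjnt (insert C others)"
  unfolding orbits_eq[symmetric] by (auto simp: pairwise_def disjnt_def dest: orbit_eq)

lemma val_others: "D \<in> others \<Longrightarrow> w \<in> D \<Longrightarrow> \<rho> w = val D"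
  using val_orbit \<rho>_orbit by (auto elim!: others_cases)

lemma val_range: "D \<in> others \<Longrightarrow> val D \<in> {1..d}"
  using \<rho>_range val_orbit by (auto elim!: others_cases)

text \<open>The realization counts all cycles of a class, and \<open>C\<close> is one of class
  \<open>(a, r)\<close>: this is the subtraction in \<open>remove_pivot\<close>. Outside the index
  range \<open>H\<close> vanishes by normalization and no cycle has such a class.\<close>

lemma card_class: "card {D \<in> others. cls D = (b, s)} = h b s"
proof (cases "1 \<le> b \<and> s \<in> {1..d}")
  case True
  have "{D \<in> orbit \<sigma> ` V. card D = b \<and> (\<forall>v\<in>D. \<rho> v = s)} = {D \<in> orbit \<sigma> ` V. cls D = (b, s)}"
  proof -
    have "(\<forall>v\<in>D. \<rho> v = s) \<longleftrightarrow> val D = s" if D: "D \<in> orbit \<sigma> ` V" for D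
    proof -
      obtain v where v: "v \<in> V" "D = orbit \<sigma> v" using D by blast
      show ?thesis
        unfolding v(2) val_orbit[OF v(1)] using \<rho>_orbit[OF v(1)] self_in_orbit[of v] by metis
    qed
    thus ?thesis by (intro Collect_cong) (auto simp: cls_def)
  qed
  moreover have "card {D \<in> orbit \<sigma> ` V. card D = b \<and> (\<forall>v\<in>D. \<rho> v = s)} = H b s"
    using realization True unfolding labeled_realization_def by blast
  ultimately have "card {D \<in> insert C others. cls D = (b, s)} = H b s"
    by (simp only: orbits_eq)
  moreover have "cls C = (a, r)" using val_orbit[OF c_in_V] by (simp add: cls_def)
  hence "{D \<in> insert C others. cls D = (b, s)} = (if (b, s) = (a, r)
      then insert C {D \<in> others. cls D = (b, s)} else {D \<in> others. cls D = (b, s)})" by auto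
  ultimately show ?thesis
    using finite_others C_notin_others by (auto simp: remove_pivot_def split: if_splits)
next
  case False
  hence "H b s = 0" using normalized by (auto simp: normalized_state_def)
  moreover have "{D \<in> others. cls D = (b, s)} = {}"
    using False val_range others_finite_pos by (force simp: cls_def)
  ultimately show ?thesis by (simp only: remove_pivot_def card.empty) auto
qed

lemma occupied_eq: "occupied h = cls ` others"
proof -
  have "h b s \<noteq> 0 \<longleftrightarrow> (b, s) \<in> cls ` others" for b s
  proof -
    have "h b s \<noteq> 0 \<longleftrightarrow> {D \<in> others. cls D = (b, s)} \<noteq> {}"
      using finite_others unfolding card_class[symmetric] by simp
    thus ?thesis by (auto simp: image_iff eq_commute[of "(b, s)"])
  qed
  thus ?thesis unfolding occupied_def by auto
qed

text \<open>A neighbourhood of the pivot vertex is recorded by its size \<open>u\<close> on the pivot cycle and by the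
  numbers \<open>\<kappa> D\<close> of edge orbits that join the pivot cycle to the cycles \<open>D\<close>.\<close>

definition multiplicities :: "nat \<Rightarrow> ('v set \<Rightarrow> nat) set" where
  "multiplicities u = {\<kappa> \<in> PiE others (\<lambda>D. {0..K_max a r (card D) (val D)}).
     u + (\<Sum>D\<in>others. \<kappa> D * alpha a (card D)) = r}"

text \<open>Restricted to \<open>others\<close> so that it can be an element of a
  \<open>PiE\<close>; for admissible \<open>N\<close> the division is exact.\<close>

definition mult_of :: "'v set \<Rightarrow> 'v set \<Rightarrow> nat" where
  "mult_of N = (\<lambda>D\<in>others. card (N \<inter> D) div alpha a (card D))"

definition residual :: "('v set \<Rightarrow> nat) \<Rightarrow> 'v \<Rightarrow> nat" where
  "residual \<kappa> w = \<rho> w - \<kappa> (orbit \<sigma> w) * beta a (card (orbit \<sigma> w))"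

lemma finite_multiplicities: "finite (multiplicities u)"
  unfolding multiplicities_def
  by (rule finite_subset[OF Collect_subset finite_PiE[OF finite_others]]) simp

text \<open>Admissibility is local. On \<open>C\<close> the power \<open>\<sigma> ^^ a\<close> is
  the identity, so only the reversal clause matters; on another cycle no power reaches
  \<open>c\<close>, so only closure under \<open>\<sigma> ^^ a\<close> matters. Hence the traces are
  independent.\<close>

lemma admissible_split:
  "admissible N \<longleftrightarrow> N \<subseteq> V \<and>
     (N \<inter> C \<subseteq> C - {c} \<and> (\<forall>x\<in>N \<inter> C. \<forall>i. (\<sigma> ^^ i) x = c \<longrightarrow> (\<sigma> ^^ i) c \<in> N \<inter> C)) \<and>
     (\<forall>D\<in>others. \<forall>x\<in>N \<inter> D. (\<sigma> ^^ a) x \<in> N \<inter> D)" (is "_ \<longleftrightarrow> ?R")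
proof
  assume N: "admissible N"
  have "(\<sigma> ^^ a) x \<in> D" if "D \<in> others" "x \<in> D" for D x
    using that by (auto elim!: others_cases intro: funpow_in_orbit)
  thus ?R using N by (auto simp: admissible_def funpow_in_orbit_self)
next
  assume R: ?R
  have "(\<sigma> ^^ a) x \<in> N" if x: "x \<in> N" for x
  proof (cases "x \<in> C")
    case True
    hence "(\<sigma> ^^ a) x = x" by (simp add: funpow_eq_self_iff orbit_eq)
    thus ?thesis using x by simp
  next
    case False
    hence "orbit \<sigma> x \<in> others" using x R by (intro orbit_in_others) auto
    thus ?thesis using R x self_in_orbit[of x] by blast
  qed
  moreover have "(\<sigma> ^^ i) c \<in> N" if "x \<in> N" "(\<sigma> ^^ i) x = c" for x i
  proof -
    have "c \<in> orbit \<sigma> x" using that funpow_in_orbit_self by blast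
    hence "x \<in> C" using orbit_eq self_in_orbit by blast
    thus ?thesis using R that by blast
  qed
  moreover have "c \<notin> N" using R self_in_orbit[of c] by blast
  ultimately show "admissible N" using R by (auto simp: admissible_def)
qed

lemma admissible_card_Int:
  assumes "admissible N" "D \<in> others"
  shows "card (N \<inter> D) = mult_of N D * alpha a (card D)" and "mult_of N D \<le> gcd a (card D)"
proof -
  obtain v where v: "v \<in> V - C" "D = orbit \<sigma> v" using assms(2) by (rule others_cases)
  let ?g = "gcd a (card D)"
  have *: "card (N \<inter> D) = alpha a (card D) * card {j. j < ?g \<and> (\<sigma> ^^ j) v \<in> N \<inter> D}"
    unfolding v(2)
    by (rule card_closed_subset_orbit[OF a_pos]) (use assms v in \<open>auto simp: admissible_split\<close>)
  hence eq: "mult_of N D = card {j. j < ?g \<and> (\<sigma> ^^ j) v \<in> N \<inter> D}"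
    using assms(2) alpha_pos[of a v] v(2) by (simp add: mult_of_def)
  show "card (N \<inter> D) = mult_of N D * alpha a (card D)" using * eq by simp
  have "card {j. j < ?g \<and> (\<sigma> ^^ j) v \<in> N \<inter> D} \<le> card {..<?g}" by (intro card_mono) auto
  thus "mult_of N D \<le> gcd a (card D)" using eq by simp
qed

text \<open>With \<open>k\<close> classes chosen on a cycle of length \<open>b\<close> there are
  \<open>a * (k * alpha a b)\<close> edges to \<open>C\<close>; by \<open>alpha_beta\<close> each of
  the \<open>b\<close> vertices receives \<open>k * beta a b\<close> of them.\<close>

lemma admissible_demand:
  assumes "admissible N" "w \<in> V - C"
  shows "demand N w = mult_of N (orbit \<sigma> w) * beta a (card (orbit \<sigma> w))"
proof -
  have "demand N w * card (orbit \<sigma> w) = a * (mult_of N (orbit \<sigma> w) * alpha a (card (orbit \<sigma> w)))"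
    using demand_other[OF assms] admissible_card_Int(1)[OF assms(1) orbit_in_others[OF assms(2)]] by simp
  also have "\<dots> = mult_of N (orbit \<sigma> w) * (a * alpha a (card (orbit \<sigma> w)))" by simp
  also have "\<dots> = mult_of N (orbit \<sigma> w) * beta a (card (orbit \<sigma> w)) * card (orbit \<sigma> w)"
    by (simp add: alpha_beta)
  finally show ?thesis using card_orbit_pos[of w] by simp
qed

lemma card_N:
  assumes "N \<subseteq> V"
  shows "card N = card (N \<inter> C) + (\<Sum>D\<in>others. card (N \<inter> D))"
proof -
  have "N = (\<Union>D\<in>insert C others. N \<inter> D)" using assms Union_orbits by blast
  hence "card N = card (\<Union>D\<in>insert C others. N \<inter> D)" by simp
  also have "\<dots> = (\<Sum>D\<in>insert C others. card (N \<inter> D))"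
  proof (rule card_UN_disjoint)
    show "\<forall>D\<in>insert C others. \<forall>D'\<in>insert C others. D \<noteq> D' \<longrightarrow> (N \<inter> D) \<inter> (N \<inter> D') = {}"
      using disjoint_orbits unfolding pairwise_def disjnt_def by blast
  qed (use finite_others others_finite_pos finite_orbit_V in auto)
  finally show ?thesis using finite_others C_notin_others by simp
qed

definition good :: "'v set set" where
  "good = {N. admissible N \<and> card N = r \<and> (\<forall>w\<in>V - C. demand N w \<le> \<rho> w)}"

lemma finite_good: "finite good"
proof -
  have "good \<subseteq> Pow V" by (auto simp: good_def admissible_def)
  thus ?thesis using finite_V by (meson finite_Pow_iff finite_subset)
qed

text \<open>Of the three limits in \<open>K_max\<close>, the one by \<open>gcd\<close> holds for
  every admissible set and the one by \<open>r\<close> follows from the total size of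
  \<open>N\<close>. The remaining one is the degree condition off the pivot cycle.\<close>

lemma good_iff:
  "N \<in> good \<longleftrightarrow> admissible N \<and> card (N \<inter> C) \<le> r \<and> mult_of N \<in> multiplicities (card (N \<inter> C))"
proof (cases "admissible N")
  case True
  let ?S = "\<Sum>D\<in>others. mult_of N D * alpha a (card D)"
  have card: "card N = card (N \<inter> C) + ?S"
    using True by (simp add: card_N admissible_split admissible_card_Int(1))
  have demand: "(\<forall>w\<in>V - C. demand N w \<le> \<rho> w) \<longleftrightarrow> (\<forall>D\<in>others. mult_of N D * beta a (card D) \<le> val D)"
    using admissible_demand[OF True] val_orbit by (auto simp: others_def)
  have K: "mult_of N D \<le> K_max a r (card D) (val D) \<longleftrightarrow> mult_of N D * beta a (card D) \<le> val D"
    if D: "D \<in> others" and r: "card (N \<inter> C) + ?S = r" for D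
  proof -
    have "mult_of N D * alpha a (card D) \<le> ?S" using finite_others D by (intro member_le_sum) auto
    thus ?thesis
      using le_K_max_iff[OF a_pos, of "card D"] others_finite_pos[OF D] admissible_card_Int(2)[OF True D] r
      by simp
  qed
  have "mult_of N \<in> extensional others" by (simp add: mult_of_def)
  hence "mult_of N \<in> multiplicities (card (N \<inter> C))
      \<longleftrightarrow> (\<forall>D\<in>others. mult_of N D \<le> K_max a r (card D) (val D)) \<and> card (N \<inter> C) + ?S = r"
    by (simp add: multiplicities_def PiE_iff)
  also have "\<dots> \<longleftrightarrow> (\<forall>D\<in>others. mult_of N D * beta a (card D) \<le> val D) \<and> card (N \<inter> C) + ?S = r"
    using K by blast
  finally show ?thesis using True card by (auto simp: good_def demand)
qed (simp add: good_def)

text \<open>Closure and size are prescribed for one trace at a time: offsets closed under negation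
  on \<open>C\<close>, unions of residue classes on the other cycles. The counts multiply.\<close>

lemma card_good_fiber:
  assumes "u \<le> r" "\<kappa> \<in> multiplicities u"
  shows "card {N \<in> good. (card (N \<inter> C), mult_of N) = (u, \<kappa>)}
       = I_coeff a u * (\<Prod>D\<in>others. gcd a (card D) choose \<kappa> D)"
proof -
  define Q where "Q D M \<longleftrightarrow> (if D = C
      then M \<subseteq> C - {c} \<and> (\<forall>x\<in>M. \<forall>i. (\<sigma> ^^ i) x = c \<longrightarrow> (\<sigma> ^^ i) c \<in> M) \<and> card M = u
      else (\<forall>x\<in>M. (\<sigma> ^^ a) x \<in> M) \<and> card M = \<kappa> D * alpha a (card D))" for D M
  \<comment> \<open>Outside \<open>others\<close> both functions are \<open>undefined\<close>, so
    agreement on the cycles suffices for equality.\<close>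
  have \<kappa>: "\<kappa> \<in> extensional others" using assms by (auto simp: multiplicities_def PiE_iff)
  have mult_iff: "mult_of N = \<kappa> \<longleftrightarrow> (\<forall>D\<in>others. card (N \<inter> D) = \<kappa> D * alpha a (card D))"
    if "admissible N" for N
  proof
    assume R: "\<forall>D\<in>others. card (N \<inter> D) = \<kappa> D * alpha a (card D)"
    show "mult_of N = \<kappa>"
    proof
      fix D show "mult_of N D = \<kappa> D"
      proof (cases "D \<in> others")
        case True
        hence "alpha a (card D) > 0" using alpha_pos by (auto elim!: others_cases)
        thus ?thesis using R True by (simp add: mult_of_def)
      qed (use \<kappa> in \<open>simp add: mult_of_def extensional_def\<close>)
    qed
  qed (use admissible_card_Int(1)[OF that] in auto)
  have "{N \<in> good. (card (N \<inter> C), mult_of N) = (u, \<kappa>)}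
      = {N. admissible N \<and> card (N \<inter> C) = u \<and> mult_of N = \<kappa>}"
    using assms by (auto simp: good_iff)
  also have "\<dots> = {N. admissible N \<and> card (N \<inter> C) = u \<and> (\<forall>D\<in>others. card (N \<inter> D) = \<kappa> D * alpha a (card D))}"
    using mult_iff by blast
  also have "\<dots> = {N. N \<subseteq> \<Union>(insert C others) \<and> (\<forall>D\<in>insert C others. Q D (N \<inter> D))}"
  proof (intro Collect_cong)
    fix N
    have "D \<noteq> C" if "D \<in> others" for D using that C_notin_others by blast
    thus "admissible N \<and> card (N \<inter> C) = u \<and> (\<forall>D\<in>others. card (N \<inter> D) = \<kappa> D * alpha a (card D))
      \<longleftrightarrow> N \<subseteq> \<Union>(insert C others) \<and> (\<forall>D\<in>insert C others. Q D (N \<inter> D))"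
      unfolding Union_orbits admissible_split Q_def by (auto simp del: Int_iff)
  qed
  also have "card \<dots> = (\<Prod>D\<in>insert C others. card {M. M \<subseteq> D \<and> Q D M})"
    using finite_others others_finite_pos finite_orbit_V disjoint_orbits
    by (intro card_subsets_of_disjoint_Union) auto
  also have "\<dots> = card {M. M \<subseteq> C \<and> Q C M} * (\<Prod>D\<in>others. card {M. M \<subseteq> D \<and> Q D M})"
    using finite_others C_notin_others by simp
  also have "{M. M \<subseteq> C \<and> Q C M}
      = {M. M \<subseteq> C - {c} \<and> (\<forall>x\<in>M. \<forall>i. (\<sigma> ^^ i) x = c \<longrightarrow> (\<sigma> ^^ i) c \<in> M) \<and> card M = u}"
    by (auto simp: Q_def)
  also have "card \<dots> = I_coeff a u" by (rule card_symmetric_subsets_orbit)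
  also have "(\<Prod>D\<in>others. card {M. M \<subseteq> D \<and> Q D M}) = (\<Prod>D\<in>others. gcd a (card D) choose \<kappa> D)"
  proof (rule prod.cong[OF refl])
    fix D assume D: "D \<in> others"
    then obtain v where v: "D = orbit \<sigma> v" by (rule others_cases)
    have "D \<noteq> C" using D C_notin_others by blast
    thus "card {M. M \<subseteq> D \<and> Q D M} = gcd a (card D) choose \<kappa> D"
      using card_closed_subsets_orbit[OF a_pos, of v "\<kappa> D"] by (simp add: Q_def v)
  qed
  finally show ?thesis .
qed

text \<open>The residual degrees depend on \<open>N\<close> only through \<open>mult_of N\<close>,
  so neighbourhoods can be grouped by their size on \<open>C\<close> and their
  multiplicities.\<close>

lemma card_invariant_completions_multiplicities:
  "card (invariant_completions V \<sigma> \<rho>) = (\<Sum>u=0..r. I_coeff a u * (\<Sum>\<kappa>\<in>multiplicities u.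
     (\<Prod>D\<in>others. gcd a (card D) choose \<kappa> D) * card (invariant_completions (V - C) \<sigma> (residual \<kappa>))))"
proof -
  define R where "R \<kappa> = card (invariant_completions (V - C) \<sigma> (residual \<kappa>))" for \<kappa>
  define T where "T = Sigma {0..r} multiplicities"
  have \<rho>_C: "\<rho> v = r" if "v \<in> C" for v using \<rho>_orbit[OF c_in_V that] .
  have "card (invariant_completions V \<sigma> \<rho>)
      = (\<Sum>N\<in>good. card (invariant_completions (V - C) \<sigma> (\<lambda>w. \<rho> w - demand N w)))"
    unfolding good_def by (rule card_invariant_completions_pivot[OF \<rho>_C])
  also have "\<dots> = (\<Sum>N\<in>good. R (mult_of N))"
  proof (rule sum.cong[OF refl])
    fix N assume "N \<in> good"
    hence "\<forall>w\<in>V - C. \<rho> w - demand N w = residual (mult_of N) w"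
      by (simp add: good_def admissible_demand residual_def)
    thus "card (invariant_completions (V - C) \<sigma> (\<lambda>w. \<rho> w - demand N w)) = R (mult_of N)"
      unfolding R_def invariant_completions_def by simp
  qed
  also have "\<dots> = (\<Sum>p\<in>T. \<Sum>N | N \<in> good \<and> (card (N \<inter> C), mult_of N) = p. R (mult_of N))"
    using finite_good finite_multiplicities
    by (intro sum.group[symmetric]) (auto simp: T_def good_iff)
  also have "\<dots> = (\<Sum>p\<in>T. card {N \<in> good. (card (N \<inter> C), mult_of N) = p} * R (snd p))"
    by (intro sum.cong refl) (auto)
  also have "\<dots> = (\<Sum>(u, \<kappa>)\<in>T. I_coeff a u * (\<Prod>D\<in>others. gcd a (card D) choose \<kappa> D) * R \<kappa>)"
    by (intro sum.cong refl) (auto simp: T_def card_good_fiber simp del: prod.inject)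
  also have "\<dots> = (\<Sum>u=0..r. \<Sum>\<kappa>\<in>multiplicities u. I_coeff a u * (\<Prod>D\<in>others. gcd a (card D) choose \<kappa> D) * R \<kappa>)"
    unfolding T_def by (rule sum.Sigma[symmetric]) (auto simp: finite_multiplicities)
  finally show ?thesis by (simp add: R_def sum_distrib_left mult.assoc)
qed

end

section \<open>Allocations and the residual realization\<close>

context pivot_realization
begin

definition allocation_of :: "('v set \<Rightarrow> nat) \<Rightarrow> nat \<Rightarrow> nat \<Rightarrow> nat \<Rightarrow> nat" where
  "allocation_of \<kappa> b s k = card {D \<in> others. cls D = (b, s) \<and> \<kappa> D = k}"

definition range_K :: "nat \<times> nat \<Rightarrow> nat set" where
  "range_K p = {0..K_max a r (fst p) (snd p)}"

lemma finite_range_K: "finite (range_K p)"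
  by (simp add: range_K_def)

lemma finite_occupied: "finite (occupied h)"
  using finite_others by (simp add: occupied_eq)

lemma occupied_range: "(b, s) \<in> occupied h \<Longrightarrow> 1 \<le> b \<and> s \<in> {1..d}"
  using val_range others_finite_pos by (force simp: occupied_eq cls_def)

lemma multiplicities_PiE:
  "\<kappa> \<in> multiplicities u \<Longrightarrow> \<kappa> \<in> PiE others (\<lambda>D. range_K (cls D))"
  by (simp add: multiplicities_def range_K_def cls_def)

lemma allocation_of_fiber:
  "allocation_of \<kappa> b s k = card {D \<in> others. (cls D, \<kappa> D) = ((b, s), k)}"
  by (simp add: allocation_of_def)

text \<open>Cycles with the same class and multiplicity contribute equally. This carries the degree
  equation between cycles and classes; its product form below does the same for the
  binomials.\<close>

lemma sum_others_by_class:
  fixes \<phi> :: "(nat \<times> nat) \<times> nat \<Rightarrow> nat"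
  assumes "\<kappa> \<in> PiE others (\<lambda>D. range_K (cls D))"
  shows "(\<Sum>D\<in>others. \<phi> (cls D, \<kappa> D))
    = (\<Sum>(b, s)\<in>occupied h. \<Sum>k=0..K_max a r b s. allocation_of \<kappa> b s k * \<phi> ((b, s), k))"
proof -
  define \<psi> where "\<psi> p = card {D \<in> others. (cls D, \<kappa> D) = p}" for p
  have "(\<Sum>D\<in>others. \<phi> (cls D, \<kappa> D))
      = (\<Sum>p\<in>Sigma (occupied h) range_K. \<Sum>D | D \<in> others \<and> (cls D, \<kappa> D) = p. \<phi> (cls D, \<kappa> D))"
    using assms finite_others finite_occupied
    by (intro sum.group[symmetric]) (auto simp: occupied_eq range_K_def PiE_iff)
  also have "\<dots> = (\<Sum>p\<in>Sigma (occupied h) range_K. \<psi> p * \<phi> p)"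
    by (intro sum.cong refl) (auto simp: \<psi>_def)
  also have "\<dots> = (\<Sum>t\<in>occupied h. \<Sum>k\<in>range_K t. \<psi> (t, k) * \<phi> (t, k))"
    using sum.Sigma[of "occupied h" range_K "\<lambda>t k. \<psi> (t, k) * \<phi> (t, k)"] finite_occupied finite_range_K
    by (simp add: case_prod_beta)
  finally show ?thesis by (simp add: range_K_def \<psi>_def allocation_of_fiber case_prod_beta)
qed

lemma prod_others_by_class:
  fixes \<phi> :: "(nat \<times> nat) \<times> nat \<Rightarrow> nat"
  assumes "\<kappa> \<in> PiE others (\<lambda>D. range_K (cls D))"
  shows "(\<Prod>D\<in>others. \<phi> (cls D, \<kappa> D))
    = (\<Prod>(b, s)\<in>occupied h. \<Prod>k=0..K_max a r b s. \<phi> ((b, s), k) ^ allocation_of \<kappa> b s k)"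
proof -
  define \<psi> where "\<psi> p = card {D \<in> others. (cls D, \<kappa> D) = p}" for p
  have "(\<Prod>D\<in>others. \<phi> (cls D, \<kappa> D))
      = (\<Prod>p\<in>Sigma (occupied h) range_K. \<Prod>D | D \<in> others \<and> (cls D, \<kappa> D) = p. \<phi> (cls D, \<kappa> D))"
    using assms finite_others finite_occupied
    by (intro prod.group[symmetric]) (auto simp: occupied_eq range_K_def PiE_iff)
  also have "\<dots> = (\<Prod>p\<in>Sigma (occupied h) range_K. \<phi> p ^ \<psi> p)"
    by (intro prod.cong refl) (auto simp: \<psi>_def)
  also have "\<dots> = (\<Prod>t\<in>occupied h. \<Prod>k\<in>range_K t. \<phi> (t, k) ^ \<psi> (t, k))"
    using prod.Sigma[of "occupied h" range_K "\<lambda>t k. \<phi> (t, k) ^ \<psi> (t, k)"] finite_occupied finite_range_K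
    by (simp add: case_prod_beta)
  finally show ?thesis by (simp add: range_K_def \<psi>_def allocation_of_fiber case_prod_beta)
qed

lemma allocation_of_in_allocations:
  assumes "\<kappa> \<in> multiplicities u"
  shows "allocation_of \<kappa> \<in> allocations d H a r u"
proof -
  note \<kappa> = multiplicities_PiE[OF assms]
  have "allocation_of \<kappa> b s k = 0" if "\<not> (1 \<le> b \<and> s \<in> {1..d} \<and> k \<le> K_max a r b s)" for b s k
  proof -
    have "\<not> (cls D = (b, s) \<and> \<kappa> D = k)" if "D \<in> others" for D
      using \<kappa> that \<open>\<not> _\<close> val_range[OF that] others_finite_pos[OF that]
      by (auto simp: range_K_def PiE_iff cls_def)
    hence "{D \<in> others. cls D = (b, s) \<and> \<kappa> D = k} = {}" by blast
    thus ?thesis by (simp only: allocation_of_def card.empty)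
  qed
  moreover have "(\<Sum>k=0..K_max a r b s. allocation_of \<kappa> b s k) = h b s" for b s
  proof -
    have "(\<Sum>k=0..K_max a r b s. allocation_of \<kappa> b s k)
        = (\<Sum>k=0..K_max a r b s. card {D \<in> {D \<in> others. cls D = (b, s)}. \<kappa> D = k})"
      by (simp add: allocation_of_def conj_assoc)
    also have "\<dots> = card {D \<in> {D \<in> others. cls D = (b, s)}. \<kappa> D \<in> {0..K_max a r b s}}"
      using finite_others by (intro sum_card_fibers) auto
    also have "{D \<in> {D \<in> others. cls D = (b, s)}. \<kappa> D \<in> {0..K_max a r b s}} = {D \<in> others. cls D = (b, s)}"
      using \<kappa> by (auto simp: range_K_def PiE_iff)
    finally show ?thesis by (simp add: card_class)
  qed
  moreover have "u + (\<Sum>(b, s)\<in>occupied h. \<Sum>k=0..K_max a r b s. k * alpha a b * allocation_of \<kappa> b s k) = r"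
    using assms sum_others_by_class[OF \<kappa>, of "\<lambda>p. snd p * alpha a (fst (fst p))"]
    by (simp add: multiplicities_def cls_def ac_simps)
  ultimately show ?thesis by (simp add: allocations_def Let_def)
qed

text \<open>The degree equation depends only on the allocation, so \<open>\<nu>\<close> passes it on
  to every \<open>\<kappa>\<close> with the prescribed counts. The fiber thus consists of all
  functions with these counts, as in \<open>card_functions_with_class_counts\<close>.\<close>

lemma card_allocation_fiber:
  assumes "\<nu> \<in> allocations d H a r u"
  shows "card {\<kappa> \<in> multiplicities u. allocation_of \<kappa> = \<nu>} * (\<Prod>(b, s)\<in>occupied h. \<Prod>k=0..K_max a r b s. fact (\<nu> b s k))
       = (\<Prod>(b, s)\<in>occupied h. fact (h b s))"
proof -
  define \<nu>' where "\<nu>' p = \<nu> (fst (fst p)) (snd (fst p)) (snd p)" for p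
  have \<nu>_sum: "(\<Sum>k=0..K_max a r b s. \<nu> b s k) = h b s" if "1 \<le> b" "s \<in> {1..d}" for b s
    using assms that unfolding allocations_def Let_def by blast
  have \<nu>_zero: "\<nu> b s k = 0" if "\<not> (1 \<le> b \<and> s \<in> {1..d} \<and> k \<le> K_max a r b s)" for b s k
    using assms that unfolding allocations_def Let_def by blast
  \<comment> \<open>In an unoccupied class the entries sum to \<open>h b s = 0\<close>, so each of
    them vanishes.\<close>
  have \<nu>_zero': "\<nu> b s k = 0" if "(b, s) \<notin> occupied h" for b s k
  proof (cases "1 \<le> b \<and> s \<in> {1..d} \<and> k \<le> K_max a r b s")
    case True
    hence "(\<Sum>k=0..K_max a r b s. \<nu> b s k) = 0" using that \<nu>_sum[of b s] by (simp add: occupied_def)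
    thus ?thesis using True by simp
  qed (rule \<nu>_zero)
  have iff: "\<kappa> \<in> multiplicities u \<and> allocation_of \<kappa> = \<nu> \<longleftrightarrow> \<kappa> \<in> PiE others (\<lambda>D. range_K (cls D)) \<and>
        (\<forall>p\<in>Sigma (occupied h) range_K. card {D \<in> others. (cls D, \<kappa> D) = p} = \<nu>' p)" (is "?L \<longleftrightarrow> ?R") for \<kappa>
  proof
    assume ?L
    thus ?R using multiplicities_PiE[of \<kappa> u] by (auto simp: \<nu>'_def allocation_of_def)
  next
    assume R: ?R
    hence \<kappa>: "\<kappa> \<in> PiE others (\<lambda>D. range_K (cls D))" by blast
    have eq: "allocation_of \<kappa> b s k = \<nu> b s k" for b s k
    proof (cases "(b, s) \<in> occupied h \<and> k \<in> range_K (b, s)")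
      case True
      thus ?thesis using R unfolding allocation_of_fiber \<nu>'_def by force
    next
      case False
      have "\<not> (cls D = (b, s) \<and> \<kappa> D = k)" if "D \<in> others" for D
      proof
        assume D: "cls D = (b, s) \<and> \<kappa> D = k"
        hence "(b, s) \<in> occupied h" unfolding occupied_eq using that by (metis image_eqI)
        moreover have "k \<in> range_K (b, s)" using PiE_mem[OF \<kappa> that] D by simp
        ultimately show False using False by blast
      qed
      hence "{D \<in> others. cls D = (b, s) \<and> \<kappa> D = k} = {}" by blast
      hence "allocation_of \<kappa> b s k = 0" by (simp only: allocation_of_def card.empty)
      thus ?thesis using False \<nu>_zero'[of b s k] \<nu>_zero[of b s k] by (auto simp: range_K_def)
    qed
    have "u + (\<Sum>(b, s)\<in>occupied h. \<Sum>k=0..K_max a r b s. k * alpha a b * \<nu> b s k) = r"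
      using assms unfolding allocations_def Let_def by blast
    hence "\<kappa> \<in> multiplicities u"
      using \<kappa> sum_others_by_class[OF \<kappa>, of "\<lambda>p. snd p * alpha a (fst (fst p))"]
      by (simp add: multiplicities_def cls_def range_K_def eq ac_simps)
    thus ?L using eq by (simp add: fun_eq_iff)
  qed
  have "card {\<kappa> \<in> PiE others (\<lambda>D. range_K (cls D)).
          \<forall>p\<in>Sigma (occupied h) range_K. card {D \<in> others. (cls D, \<kappa> D) = p} = \<nu>' p}
      * (\<Prod>p\<in>Sigma (occupied h) range_K. fact (\<nu>' p))
      = (\<Prod>t\<in>occupied h. fact (card {D \<in> others. cls D = t}))"
  proof (rule card_functions_with_class_counts[OF finite_others finite_occupied])
    fix t assume "t \<in> occupied h"
    thus "(\<Sum>k\<in>range_K t. \<nu>' (t, k)) = card {D \<in> others. cls D = t}"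
      using \<nu>_sum occupied_range by (cases t) (simp add: range_K_def \<nu>'_def card_class)
  qed (auto simp: range_K_def occupied_eq)
  moreover have "(\<Prod>p\<in>Sigma (occupied h) range_K. fact (\<nu>' p) :: nat)
      = (\<Prod>(b, s)\<in>occupied h. \<Prod>k=0..K_max a r b s. fact (\<nu> b s k))"
  proof -
    have "(\<Prod>p\<in>Sigma (occupied h) range_K. fact (\<nu>' p) :: nat) = (\<Prod>t\<in>occupied h. \<Prod>k\<in>range_K t. fact (\<nu>' (t, k)))"
      using prod.Sigma[of "occupied h" range_K "\<lambda>t k. fact (\<nu>' (t, k)) :: nat"] finite_occupied finite_range_K
      by (simp add: case_prod_beta)
    thus ?thesis by (simp add: range_K_def \<nu>'_def case_prod_beta)
  qed
  moreover have "(\<Prod>t\<in>occupied h. fact (card {D \<in> others. cls D = t}) :: nat) = (\<Prod>(b, s)\<in>occupied h. fact (h b s))"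
    by (intro prod.cong refl) (auto simp: card_class)
  ultimately show ?thesis using iff by simp
qed

text \<open>Surjectivity comes from counting: the product of factorials is nonzero, so no fiber over
  an allocation is empty.\<close>

lemma allocations_eq: "allocations d H a r u = allocation_of ` multiplicities u"
proof
  show "allocation_of ` multiplicities u \<subseteq> allocations d H a r u"
    using allocation_of_in_allocations by blast
  show "allocations d H a r u \<subseteq> allocation_of ` multiplicities u"
  proof
    fix \<nu> assume "\<nu> \<in> allocations d H a r u"
    from card_allocation_fiber[OF this] have "card {\<kappa> \<in> multiplicities u. allocation_of \<kappa> = \<nu>} \<noteq> 0"
      using finite_occupied by (intro notI) (auto simp: prod_zero_iff)
    hence "{\<kappa> \<in> multiplicities u. allocation_of \<kappa> = \<nu>} \<noteq> {}" by force
    thus "\<nu> \<in> allocation_of ` multiplicities u" by blast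
  qed
qed

text \<open>\<open>weight\<close> divides in each class separately. Divisibility holds class by
  class, so the quotients multiply to the fiber size known in multiplied-out form.\<close>

lemma card_allocation_fiber_weight:
  assumes "\<nu> \<in> allocations d H a r u"
  shows "card {\<kappa> \<in> multiplicities u. allocation_of \<kappa> = \<nu>}
           * (\<Prod>(b, s)\<in>occupied h. \<Prod>k=0..K_max a r b s. (gcd a b choose k) ^ \<nu> b s k)
       = (\<Prod>(b, s)\<in>occupied h. weight H a r \<nu> b s)"
proof -
  define P where "P t = (\<Prod>k=0..K_max a r (fst t) (snd t). fact (\<nu> (fst t) (snd t) k) :: nat)" for t
  have "P t dvd fact (h (fst t) (snd t))" if "t \<in> occupied h" for t
  proof -
    have "(\<Sum>k=0..K_max a r (fst t) (snd t). \<nu> (fst t) (snd t) k) = h (fst t) (snd t)"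
      using assms occupied_range[of "fst t" "snd t"] that unfolding allocations_def Let_def by simp
    thus ?thesis
      using prod_fact_dvd_fact_sum[of "{0..K_max a r (fst t) (snd t)}" "\<nu> (fst t) (snd t)"]
      by (simp add: P_def)
  qed
  hence "(\<Prod>t\<in>occupied h. fact (h (fst t) (snd t)) div P t * P t) = (\<Prod>t\<in>occupied h. fact (h (fst t) (snd t)))"
    by (intro prod.cong refl) simp
  hence "card {\<kappa> \<in> multiplicities u. allocation_of \<kappa> = \<nu>} * (\<Prod>t\<in>occupied h. P t)
      = (\<Prod>t\<in>occupied h. fact (h (fst t) (snd t)) div P t) * (\<Prod>t\<in>occupied h. P t)"
    using card_allocation_fiber[OF assms] by (simp add: P_def prod.distrib case_prod_beta)
  moreover have "(\<Prod>t\<in>occupied h. P t) > 0" by (simp add: P_def prod_pos)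
  ultimately have "card {\<kappa> \<in> multiplicities u. allocation_of \<kappa> = \<nu>}
      = (\<Prod>t\<in>occupied h. fact (h (fst t) (snd t)) div P t)" by simp
  thus ?thesis by (simp add: weight_def P_def prod.distrib case_prod_beta)
qed

text \<open>The summand sees \<open>\<kappa>\<close> only through its allocation, so the sum is
  grouped by fibers, whose sizes supply the multinomial part of the weights. \<open>G\<close> will
  be the value at the next state.\<close>

lemma sum_multiplicities:
  "(\<Sum>\<kappa>\<in>multiplicities u. (\<Prod>D\<in>others. gcd a (card D) choose \<kappa> D) * G (allocation_of \<kappa>))
   = (\<Sum>\<nu>\<in>allocations d H a r u. (\<Prod>(b, s)\<in>occupied h. weight H a r \<nu> b s) * G \<nu>)"
proof -
  define Z where "Z \<nu> = (\<Prod>(b, s)\<in>occupied h. \<Prod>k=0..K_max a r b s. (gcd a b choose k) ^ \<nu> b s k)"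
    for \<nu> :: "nat \<Rightarrow> nat \<Rightarrow> nat \<Rightarrow> nat"
  have "(\<Sum>\<kappa>\<in>multiplicities u. (\<Prod>D\<in>others. gcd a (card D) choose \<kappa> D) * G (allocation_of \<kappa>))
      = (\<Sum>\<kappa>\<in>multiplicities u. Z (allocation_of \<kappa>) * G (allocation_of \<kappa>))"
  proof (rule sum.cong[OF refl])
    fix \<kappa> assume "\<kappa> \<in> multiplicities u"
    from prod_others_by_class[OF multiplicities_PiE[OF this], of "\<lambda>p. gcd a (fst (fst p)) choose snd p"]
    show "(\<Prod>D\<in>others. gcd a (card D) choose \<kappa> D) * G (allocation_of \<kappa>)
        = Z (allocation_of \<kappa>) * G (allocation_of \<kappa>)"
      by (simp add: cls_def Z_def)
  qed
  also have "\<dots> = (\<Sum>\<nu>\<in>allocations d H a r u. \<Sum>\<kappa> | \<kappa> \<in> multiplicities u \<and> allocation_of \<kappa> = \<nu>.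
      Z (allocation_of \<kappa>) * G (allocation_of \<kappa>))"
    by (rule sum.group[symmetric]) (auto simp: finite_multiplicities allocations_eq)
  also have "\<dots> = (\<Sum>\<nu>\<in>allocations d H a r u. card {\<kappa> \<in> multiplicities u. allocation_of \<kappa> = \<nu>} * Z \<nu> * G \<nu>)"
    by (intro sum.cong refl) simp
  also have "\<dots> = (\<Sum>\<nu>\<in>allocations d H a r u. (\<Prod>(b, s)\<in>occupied h. weight H a r \<nu> b s) * G \<nu>)"
    by (intro sum.cong refl) (simp add: Z_def card_allocation_fiber_weight)
  finally show ?thesis .
qed

text \<open>A realization has degrees in \<open>{1..d}\<close> only, so vertices whose degree has
  dropped to 0 leave together with the pivot cycle, just as \<open>next_state\<close> drops their
  cycles.\<close>

definition rest :: "('v set \<Rightarrow> nat) \<Rightarrow> 'v set" where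
  "rest \<kappa> = {w \<in> V - C. residual \<kappa> w > 0}"

lemma residual_orbit:
  assumes "D \<in> others" "w \<in> D"
  shows "residual \<kappa> w = val D - \<kappa> D * beta a (card D)"
proof -
  have "orbit \<sigma> w = D" using assms orbit_eq by (auto elim!: others_cases)
  thus ?thesis using val_others[OF assms] by (simp add: residual_def)
qed

lemma orbit_subset_rest:
  assumes "w \<in> rest \<kappa>"
  shows "orbit \<sigma> w \<subseteq> rest \<kappa>"
proof -
  have w: "w \<in> V - C" "residual \<kappa> w > 0" using assms by (auto simp: rest_def)
  note D = orbit_in_others[OF w(1)]
  show ?thesis
    using others_subset[OF D] w(2) residual_orbit[OF D] self_in_orbit[of w] by (auto simp: rest_def)
qed

lemma rest_image: "\<sigma> ` rest \<kappa> \<subseteq> rest \<kappa>"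
  using orbit_subset_rest orbit.base by (metis image_subsetI subsetD)

text \<open>\<open>permutes\<close> requires the identity outside the set, whereas
  \<open>\<sigma>\<close> may still move deleted vertices; hence the restriction.\<close>

lemma rest_permutes: "perm_restrict \<sigma> (rest \<kappa>) permutes rest \<kappa>"
proof (rule bij_imp_permutes)
  have fin: "finite (rest \<kappa>)" using finite_V by (simp add: rest_def)
  have inj: "inj_on \<sigma> (rest \<kappa>)" using permutes_inj[OF permutes] by (rule inj_on_subset) simp
  have "\<sigma> ` rest \<kappa> = rest \<kappa>" using endo_inj_surj[OF fin rest_image inj] .
  thus "bij_betw (perm_restrict \<sigma> (rest \<kappa>)) (rest \<kappa>) (rest \<kappa>)"
    using inj by (simp add: bij_betw_def perm_restrict_def cong: inj_on_cong image_cong)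
qed (simp add: perm_restrict_simps)

lemma orbit_rest:
  assumes "w \<in> rest \<kappa>"
  shows "orbit (perm_restrict \<sigma> (rest \<kappa>)) w = orbit \<sigma> w"
  using orbit_subset_rest[OF assms] by (intro orbit_cong self_in_orbit) (auto simp: perm_restrict_simps)

text \<open>A vertex of residual degree 0 lies on no edge, so its deletion changes no completion; on
  edges inside \<open>rest \<kappa>\<close> the restricted permutation acts as
  \<open>\<sigma>\<close>.\<close>

lemma invariant_completions_rest:
  "invariant_completions (rest \<kappa>) (perm_restrict \<sigma> (rest \<kappa>)) (residual \<kappa>)
   = invariant_completions (V - C) \<sigma> (residual \<kappa>)"
proof -
  have "invariant_completions (rest \<kappa>) (perm_restrict \<sigma> (rest \<kappa>)) (residual \<kappa>)
      = invariant_completions (rest \<kappa>) \<sigma> (residual \<kappa>)"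
  proof -
    have "(\<lambda>e. perm_restrict \<sigma> (rest \<kappa>) ` e) ` E = (\<lambda>e. \<sigma> ` e) ` E"
      if "E \<subseteq> {e. e \<subseteq> rest \<kappa> \<and> card e = 2}" for E
    proof (rule image_cong[OF refl])
      fix e assume "e \<in> E"
      hence "e \<subseteq> rest \<kappa>" using that by blast
      thus "perm_restrict \<sigma> (rest \<kappa>) ` e = \<sigma> ` e"
        by (intro image_cong refl) (auto simp: perm_restrict_simps)
    qed
    thus ?thesis unfolding invariant_completions_def by (intro Collect_cong) (simp cong: conj_cong)
  qed
  also have "\<dots> = invariant_completions (V - C) \<sigma> (residual \<kappa>)"
  proof -
    have sub: "rest \<kappa> \<subseteq> V - C" by (auto simp: rest_def)
    have fin: "finite (neighbours E v)" if "invariant_edges (V - C) E" for E v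
      using neighbours_subset[OF that] finite_V by (meson finite_Diff finite_subset)
    have "invariant_edges (rest \<kappa>) E \<and> (\<forall>v\<in>rest \<kappa>. card (neighbours E v) = residual \<kappa> v)
      \<longleftrightarrow> invariant_edges (V - C) E \<and> (\<forall>v\<in>V - C. card (neighbours E v) = residual \<kappa> v)" (is "?L \<longleftrightarrow> ?R") for E
    proof
      assume L: ?L
      hence inv: "invariant_edges (V - C) E" using sub unfolding invariant_edges_def by blast
      moreover have "card (neighbours E v) = residual \<kappa> v" if v: "v \<in> V - C" for v
      proof (cases "v \<in> rest \<kappa>")
        case False
        have "w \<notin> neighbours E v" for w
          using False neighbours_sym[of w E v] L neighbours_subset[of "rest \<kappa>" E w] by blast
        hence "neighbours E v = {}" by blast
        thus ?thesis using False v by (simp add: rest_def)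
      qed (use L in blast)
      ultimately show ?R by blast
    next
      assume R: ?R
      have "e \<subseteq> rest \<kappa>" if e: "e \<in> E" for e
      proof
        fix v assume v: "v \<in> e"
        have "e \<subseteq> V - C" "card e = 2" using R e by (auto simp: invariant_edges_def)
        hence "v \<in> V - C" "\<exists>w. e = {v, w}" using v by (auto simp: card_2_iff)
        hence "neighbours E v \<noteq> {}" using e by (auto simp: neighbours_def)
        hence "card (neighbours E v) > 0" using fin R by (simp add: card_gt_0_iff)
        thus "v \<in> rest \<kappa>" using R \<open>v \<in> V - C\<close> by (simp add: rest_def)
      qed
      thus ?L using R sub unfolding invariant_edges_def by blast
    qed
    moreover have "rest \<kappa> \<subseteq> V" using sub by blast
    ultimately show ?thesis by (simp only: invariant_completions_eq Diff_subset)
  qed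
  finally show ?thesis .
qed

lemma orbits_rest:
  "orbit (perm_restrict \<sigma> (rest \<kappa>)) ` rest \<kappa> = {D \<in> others. val D - \<kappa> D * beta a (card D) > 0}"
proof -
  have "orbit (perm_restrict \<sigma> (rest \<kappa>)) ` rest \<kappa> = orbit \<sigma> ` rest \<kappa>"
    by (intro image_cong refl orbit_rest)
  also have "\<dots> = {D \<in> others. val D - \<kappa> D * beta a (card D) > 0}"
  proof -
    have "residual \<kappa> w = val (orbit \<sigma> w) - \<kappa> (orbit \<sigma> w) * beta a (card (orbit \<sigma> w))" if "w \<in> V - C" for w
      using residual_orbit[OF orbit_in_others[OF that] self_in_orbit] .
    thus ?thesis by (auto simp: rest_def others_def)
  qed
  finally show ?thesis .
qed

text \<open>Cycles keep their length while their value drops from \<open>s\<close> by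
  \<open>k * beta a b\<close>, so class \<open>(b, t)\<close> collects the pairs
  \<open>(s, k)\<close> with \<open>s = t + k * beta a b\<close>.\<close>

lemma realization_rest:
  assumes \<kappa>: "\<kappa> \<in> multiplicities u"
  shows "labeled_realization d (next_state d a r (allocation_of \<kappa>)) (rest \<kappa>)
           (perm_restrict \<sigma> (rest \<kappa>)) (residual \<kappa>)"
  unfolding labeled_realization_def
proof (intro conjI ballI allI impI)
  show "finite (rest \<kappa>)" using finite_V by (simp add: rest_def)
  show "perm_restrict \<sigma> (rest \<kappa>) permutes rest \<kappa>" by (rule rest_permutes)
  show "residual \<kappa> ` rest \<kappa> \<subseteq> {1..d}"
    using \<rho>_range by (fastforce simp: rest_def residual_def)
  show "residual \<kappa> w = residual \<kappa> v"
    if "v \<in> rest \<kappa>" "w \<in> orbit (perm_restrict \<sigma> (rest \<kappa>)) v" for v w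
  proof -
    have "orbit \<sigma> v \<in> others" using that by (intro orbit_in_others) (simp add: rest_def)
    thus ?thesis using that residual_orbit[of "orbit \<sigma> v"] self_in_orbit[of v] by (simp add: orbit_rest)
  qed
  fix b t :: nat assume bt: "1 \<le> b" "t \<in> {1..d}"
  have pos: "0 < t" using bt by simp
  define S where "S = (SIGMA s:{1..d}. {k. k \<le> K_max a r b s \<and> s = t + k * beta a b})"
  have "{D \<in> orbit (perm_restrict \<sigma> (rest \<kappa>)) ` rest \<kappa>. card D = b \<and> (\<forall>v\<in>D. residual \<kappa> v = t)}
      = {D \<in> others. card D = b \<and> val D - \<kappa> D * beta a (card D) = t}"
  proof -
    have "(\<forall>v\<in>D. residual \<kappa> v = t) \<longleftrightarrow> val D - \<kappa> D * beta a (card D) = t" if "D \<in> others" for D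
    proof -
      have "D \<noteq> {}" using others_finite_pos[OF that] by auto
      thus ?thesis using residual_orbit[OF that] by auto
    qed
    thus ?thesis unfolding orbits_rest using pos by auto
  qed
  also have "\<dots> = {D \<in> {D \<in> others. card D = b}. (val D, \<kappa> D) \<in> S}"
  proof -
    \<comment> \<open>As \<open>t\<close> is positive, the difference is not truncated and can be
      rewritten as a sum.\<close>
    have "val D - \<kappa> D * beta a (card D) = t \<longleftrightarrow> (val D, \<kappa> D) \<in> S" if D: "D \<in> others" "card D = b" for D
    proof -
      have "\<kappa> D \<le> K_max a r b (val D)"
        using \<kappa> D by (auto simp: multiplicities_def PiE_iff)
      thus ?thesis using val_range[OF D(1)] pos D by (auto simp: S_def)
    qed
    thus ?thesis by blast
  qed
  also have "card \<dots> = (\<Sum>p\<in>S. card {D \<in> {D \<in> others. card D = b}. (val D, \<kappa> D) = p})"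
    using finite_others by (intro sum_card_fibers[symmetric]) (auto simp: S_def)
  also have "\<dots> = (\<Sum>(s, k)\<in>S. allocation_of \<kappa> b s k)"
    by (intro sum.cong refl) (auto simp: allocation_of_def cls_def intro!: arg_cong[where f = card])
  also have "\<dots> = (\<Sum>s=1..d. \<Sum>k | k \<le> K_max a r b s \<and> s = t + k * beta a b. allocation_of \<kappa> b s k)"
    unfolding S_def by (rule sum.Sigma[symmetric]) auto
  also have "\<dots> = next_state d a r (allocation_of \<kappa>) b t"
    using bt by (simp add: next_state_def)
  finally show "card {D \<in> orbit (perm_restrict \<sigma> (rest \<kappa>)) ` rest \<kappa>. card D = b \<and> (\<forall>v\<in>D. residual \<kappa> v = t)}
      = next_state d a r (allocation_of \<kappa>) b t" .
qed

end

section \<open>The recurrence step for an arbitrary realization\<close>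

lemma normalized_stateI:
  assumes "labeled_realization d H V \<sigma> \<rho>" "\<And>a r. \<not> (1 \<le> a \<and> r \<in> {1..d}) \<Longrightarrow> H a r = 0"
  shows "normalized_state d H"
  unfolding normalized_state_def
proof
  have fin: "finite V" "\<sigma> permutes V" using assms by (auto simp: labeled_realization_def)
  \<comment> \<open>A nonzero entry is witnessed by a cycle inside \<open>V\<close>, which bounds
    its length by \<open>card V\<close>.\<close>
  have "{(a, r). H a r \<noteq> 0} \<subseteq> {..card V} \<times> {1..d}"
  proof clarify
    fix a r assume H: "H a r > 0"
    hence ar: "1 \<le> a" "r \<in> {1..d}" using assms(2)[of a r] by auto
    hence "card {C \<in> orbit \<sigma> ` V. card C = a \<and> (\<forall>v\<in>C. \<rho> v = r)} = H a r"
      using assms(1) by (simp add: labeled_realization_def)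
    hence "{C \<in> orbit \<sigma> ` V. card C = a \<and> (\<forall>v\<in>C. \<rho> v = r)} \<noteq> {}" using H by force
    then obtain v where "v \<in> V" "card (orbit \<sigma> v) = a" by blast
    hence "a \<le> card V" using card_mono[OF fin(1) permutes_orbit_subset[OF fin(2)]] by blast
    thus "a \<in> {..card V} \<and> r \<in> {1..d}" using ar by simp
  qed
  thus "finite {(a, r). H a r \<noteq> 0}" by (rule finite_subset) simp
  show "\<forall>a r. H a r \<noteq> 0 \<longrightarrow> 1 \<le> a \<and> r \<in> {1..d}" using assms(2) by (metis (lifting))
qed

text \<open>An assumption about proper subsets is enough because the residual realization lives
  inside \<open>V\<close> and lacks the pivot vertex.\<close>

lemma card_invariant_completions_step:
  fixes V :: "'v set" and F :: "state \<Rightarrow> nat"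
  assumes real: "labeled_realization d H V \<sigma> \<rho>" and norm: "normalized_state d H" and pos: "H a r > 0"
    and smaller: "\<And>H' V' \<sigma>' \<rho>'. V' \<subset> V \<Longrightarrow> labeled_realization d H' V' \<sigma>' \<rho>' \<Longrightarrow> normalized_state d H'
      \<Longrightarrow> card (invariant_completions V' \<sigma>' \<rho>') = F H'"
  shows "card (invariant_completions V \<sigma> \<rho>) = recurrence_rhs d F H a r"
proof -
  have fin: "finite V" "\<sigma> permutes V" using real by (auto simp: labeled_realization_def)
  interpret finite_perm V \<sigma> using fin by unfold_locales
  have "1 \<le> a" "r \<in> {1..d}" using norm pos by (auto simp: normalized_state_def)
  hence "card {C \<in> orbit \<sigma> ` V. card C = a \<and> (\<forall>v\<in>C. \<rho> v = r)} = H a r"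
    using real by (simp add: labeled_realization_def)
  hence "{C \<in> orbit \<sigma> ` V. card C = a \<and> (\<forall>v\<in>C. \<rho> v = r)} \<noteq> {}" using pos by force
  then obtain c where c: "c \<in> V" "card (orbit \<sigma> c) = a" "\<forall>v\<in>orbit \<sigma> c. \<rho> v = r" by blast
  hence rc: "\<rho> c = r" using self_in_orbit by blast
  interpret pivot_realization V \<sigma> c d H \<rho>
    using c real norm by unfold_locales
  have "card (invariant_completions (V - orbit \<sigma> c) \<sigma> (residual \<kappa>)) = F (next_state d a r (allocation_of \<kappa>))"
    if "\<kappa> \<in> multiplicities u" for \<kappa> u
  proof -
    have "labeled_realization d (next_state d a r (allocation_of \<kappa>)) (rest \<kappa>)
        (perm_restrict \<sigma> (rest \<kappa>)) (residual \<kappa>)"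
      using realization_rest[OF that] c rc by simp
    moreover from this have "normalized_state d (next_state d a r (allocation_of \<kappa>))"
      by (rule normalized_stateI) (auto simp: next_state_def)
    moreover have "c \<notin> rest \<kappa>" "rest \<kappa> \<subseteq> V" using self_in_orbit by (auto simp: rest_def)
    hence "rest \<kappa> \<subset> V" using c by blast
    ultimately show ?thesis using smaller invariant_completions_rest by metis
  qed
  thus ?thesis
    using sum_multiplicities[where G = "\<lambda>\<nu>. F (next_state d a r \<nu>)"]
    by (simp add: card_invariant_completions_multiplicities recurrence_rhs_def c(2) rc)
qed

section \<open>Uniqueness, existence and the recurrence\<close>

text \<open>Any vertex would put a cycle into a class of the index range, so \<open>V\<close> is
  empty and the empty edge set is the only completion.\<close>

lemma realization_zero_state:
  assumes "labeled_realization d zero_state V \<sigma> \<rho>"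
  shows "card (invariant_completions V \<sigma> \<rho>) = 1"
proof -
  interpret finite_perm V \<sigma> using assms by unfold_locales (auto simp: labeled_realization_def)
  have "V = {}"
  proof (rule equals0I)
    fix v assume v: "v \<in> V"
    hence "\<rho> v \<in> {1..d}" using assms by (auto simp: labeled_realization_def)
    moreover have "1 \<le> card (orbit \<sigma> v)" using card_orbit_pos[of v] by simp
    ultimately have "card {C \<in> orbit \<sigma> ` V. card C = card (orbit \<sigma> v) \<and> (\<forall>w\<in>C. \<rho> w = \<rho> v)} = 0"
      using assms by (simp add: labeled_realization_def)
    hence "{C \<in> orbit \<sigma> ` V. card C = card (orbit \<sigma> v) \<and> (\<forall>w\<in>C. \<rho> w = \<rho> v)} = {}"
      using finite_V by simp
    moreover have "\<forall>w\<in>orbit \<sigma> v. \<rho> w = \<rho> v" using assms v by (auto simp: labeled_realization_def)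
    ultimately show False using v by blast
  qed
  hence "invariant_completions V \<sigma> \<rho> = {{}}" by (auto simp: invariant_completions_def)
  thus ?thesis by simp
qed

lemma nonzero_state: "H \<noteq> zero_state \<Longrightarrow> \<exists>a r. H a r > (0 :: nat)"
  by (rule ccontr) (auto simp: fun_eq_iff)

text \<open>A common bound \<open>n\<close> on both sizes carries the induction: both counts equal
  the same right-hand side, evaluated at counts on fewer vertices.\<close>

lemma card_invariant_completions_unique:
  fixes V V' :: "'v set"
  assumes "labeled_realization d H V \<sigma> \<rho>" "labeled_realization d H V' \<sigma>' \<rho>'" "normalized_state d H"
  shows "card (invariant_completions V \<sigma> \<rho>) = card (invariant_completions V' \<sigma>' \<rho>')"
proof -
  have "card (invariant_completions V \<sigma> \<rho>) = card (invariant_completions V' \<sigma>' \<rho>')"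
    if "labeled_realization d H V \<sigma> \<rho>" "labeled_realization d H V' \<sigma>' \<rho>'" "normalized_state d H"
      "card V < n" "card V' < n" for n H and V V' :: "'v set" and \<sigma> \<rho> \<sigma>' \<rho>'
    using that
  proof (induction n arbitrary: H V V' \<sigma> \<rho> \<sigma>' \<rho>')
    case (Suc n)
    show ?case
    proof (cases "H = zero_state")
      case True
      thus ?thesis using Suc.prems realization_zero_state by metis
    next
      case False
      then obtain a r where pos: "H a r > 0" using nonzero_state by blast
      define Q where "Q H m \<longleftrightarrow> (\<exists>(V :: 'v set) \<sigma> \<rho>. labeled_realization d H V \<sigma> \<rho> \<and> card V < n
          \<and> m = card (invariant_completions V \<sigma> \<rho>))" for H m
      \<comment> \<open>\<open>F\<close> selects the count of some realization on fewer than
        \<open>n\<close> points; by the induction hypothesis all of them share it.\<close>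
      define F where "F H = (SOME m. Q H m)" for H
      have F: "card (invariant_completions W \<sigma> \<rho>) = F H"
        if W: "labeled_realization d H W \<sigma> \<rho>" "normalized_state d H" "card W < n" for H and W :: "'v set" and \<sigma> \<rho>
      proof -
        have "Q H (card (invariant_completions W \<sigma> \<rho>))" using W by (auto simp: Q_def)
        hence "Q H (F H)" unfolding F_def by (rule someI)
        thus ?thesis using Suc.IH[OF W(1) _ W(2,3)] by (auto simp: Q_def)
      qed
      have "card (invariant_completions W \<sigma> \<rho>) = recurrence_rhs d F H a r"
        if W: "labeled_realization d H W \<sigma> \<rho>" "card W < Suc n" for W :: "'v set" and \<sigma> \<rho>
      proof (rule card_invariant_completions_step[OF W(1) Suc.prems(3) pos])
        fix H' W' \<sigma>' \<rho>' assume W': "W' \<subset> W" "labeled_realization d H' W' \<sigma>' \<rho>'" "normalized_state d H'"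
        have "finite W" using W(1) by (simp add: labeled_realization_def)
        hence "card W' < n" using psubset_card_mono[OF _ W'(1)] W(2) by linarith
        thus "card (invariant_completions W' \<sigma>' \<rho>') = F H'" using F W' by blast
      qed
      thus ?thesis using Suc.prems by metis
    qed
  qed simp
  from this[OF assms, of "Suc (max (card V) (card V'))"] show ?thesis by simp
qed

lemma card_invariant_completions_eq_Phi:
  fixes V :: "nat set"
  assumes "labeled_realization d H V \<sigma> \<rho>" "normalized_state d H"
  shows "card (invariant_completions V \<sigma> \<rho>) = Phi d H"
proof -
  have "\<exists>(W :: nat set) \<sigma>' \<rho>'. labeled_realization d H W \<sigma>' \<rho>' \<and> Phi d H = card (invariant_completions W \<sigma>' \<rho>')"
    unfolding Phi_def by (rule someI_ex) (use assms in blast)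
  thus ?thesis using card_invariant_completions_unique[OF assms(1) _ assms(2)] by auto
qed

text \<open>The point \<open>(b, s, i, j)\<close> is position \<open>j\<close> on the
  \<open>i\<close>-th cycle of class \<open>(b, s)\<close>, and \<open>\<sigma>\<close> advances the
  position modulo \<open>b\<close>. The coding by \<open>to_nat\<close> is there because
  \<open>Phi\<close> refers to realizations on \<open>nat\<close>.\<close>

lemma exists_realization:
  assumes "normalized_state d H"
  shows "\<exists>(V :: nat set) \<sigma> \<rho>. labeled_realization d H V \<sigma> \<rho>"
proof -
  define e :: "nat \<times> nat \<times> nat \<times> nat \<Rightarrow> nat" where "e = to_nat"
  have e_inj: "e x = e y \<longleftrightarrow> x = y" for x y unfolding e_def by (rule inj_eq[OF inj_to_nat])
  define X where "X = {(b, s, i, j). i < H b s \<and> j < b}"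
  define V where "V = e ` X"
  define \<sigma> where "\<sigma> n = (if n \<in> V then case from_nat n of (b, s, i, j) \<Rightarrow> e (b, s, i, Suc j mod b) else n)" for n
  define \<rho> where "\<rho> n = (case from_nat n of (b :: nat, s :: nat, i :: nat, j :: nat) \<Rightarrow> s)" for n :: nat
  define cyc where "cyc = (\<lambda>(b, s, i). (\<lambda>j. e (b, s, i, j)) ` {..<b})"
  have H: "b \<ge> 1 \<and> s \<in> {1..d}" if "i < H b s" for b s i
    using assms that unfolding normalized_state_def by (metis less_nat_zero_code)
  have fin: "finite V"
  proof -
    have "finite {(b, s). H b s \<noteq> 0}" using assms by (simp add: normalized_state_def)
    hence "finite (SIGMA p:{(b, s). H b s \<noteq> 0}. {..<H (fst p) (snd p)} \<times> {..<fst p})" by auto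
    moreover have "X \<subseteq> (\<lambda>((b, s), i, j). (b, s, i, j)) ` (SIGMA p:{(b, s). H b s \<noteq> 0}. {..<H (fst p) (snd p)} \<times> {..<fst p})"
      by (force simp: X_def)
    ultimately show ?thesis unfolding V_def by (meson finite_imageI finite_subset)
  qed
  have V_iff: "e x \<in> V \<longleftrightarrow> x \<in> X" for x by (auto simp: V_def e_inj)
  have \<sigma>: "\<sigma> (e (b, s, i, j)) = e (b, s, i, Suc j mod b)" if "(b, s, i, j) \<in> X" for b s i j
    using that V_iff[of "(b, s, i, j)"] by (simp add: \<sigma>_def) (simp add: e_def)
  have \<rho>: "\<rho> (e (b, s, i, j)) = s" for b s i j by (simp add: \<rho>_def e_def)
  have step: "(b, s, i, k mod b) \<in> X" if "(b, s, i, j) \<in> X" for b s i j k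
    using that by (auto simp: X_def)
  have "bij_betw \<sigma> V V"
  proof -
    have "\<sigma> ` V \<subseteq> V" using \<sigma> step V_iff by (auto simp: V_def)
    moreover have "inj_on \<sigma> V"
    proof (rule inj_onI)
      fix x y assume "x \<in> V" "y \<in> V" and eq: "\<sigma> x = \<sigma> y"
      then obtain b s i j b' s' i' j' where xy: "x = e (b, s, i, j)" "(b, s, i, j) \<in> X"
        "y = e (b', s', i', j')" "(b', s', i', j') \<in> X" by (auto simp: V_def)
      hence "b = b'" "s = s'" "i = i'" "Suc j mod b = Suc j' mod b" "j < b" "j' < b"
        using eq \<sigma>[OF xy(2)] \<sigma>[OF xy(4)] by (auto simp: e_inj X_def)
      thus "x = y" using xy by (auto simp: mod_Suc split: if_splits)
    qed
    ultimately show ?thesis using endo_inj_surj[OF fin] by (simp add: bij_betw_def)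
  qed
  hence perm: "\<sigma> permutes V" by (rule bij_imp_permutes) (simp add: \<sigma>_def)
  interpret finite_perm V \<sigma> using fin perm by unfold_locales
  have funpow: "(\<sigma> ^^ k) (e (b, s, i, j)) = e (b, s, i, (j + k) mod b)" if "(b, s, i, j) \<in> X" for b s i j k
  proof (induction k)
    case (Suc k)
    thus ?case using \<sigma>[OF step[OF that, of "j + k"]] by (simp add: mod_Suc_eq)
  qed (use that in \<open>simp add: X_def\<close>)
  have orbit: "orbit \<sigma> (e (b, s, i, j)) = cyc (b, s, i)" if x: "(b, s, i, j) \<in> X" for b s i j
  proof -
    have jb: "j < b" using x by (simp add: X_def)
    have "e (b, s, i, l) \<in> range (\<lambda>k. e (b, s, i, (j + k) mod b))" if "l < b" for l
    proof (rule image_eqI)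
      \<comment> \<open>From \<open>j\<close> the position \<open>l\<close> is reached by finishing
        the turn in \<open>b - j\<close> steps and taking \<open>l\<close> more.\<close>
      show "e (b, s, i, l) = e (b, s, i, (j + (l + (b - j))) mod b)" using that jb by simp
    qed simp
    thus ?thesis using jb by (auto simp: orbit_funpow funpow[OF x] cyc_def)
  qed
  have orbits: "orbit \<sigma> ` V = cyc ` {(b, s, i). i < H b s}"
  proof
    show "orbit \<sigma> ` V \<subseteq> cyc ` {(b, s, i). i < H b s}"
      using orbit by (auto simp: V_def X_def)
    show "cyc ` {(b, s, i). i < H b s} \<subseteq> orbit \<sigma> ` V"
    proof clarify
      fix b s i assume i: "i < H b s"
      \<comment> \<open>Normalization gives \<open>b \<ge> 1\<close>, so the cycle has a position
        0.\<close>
      hence "(b, s, i, 0) \<in> X" using H by (force simp: X_def)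
      thus "cyc (b, s, i) \<in> orbit \<sigma> ` V" using orbit[of b s i 0] V_iff by blast
    qed
  qed
  have card_cyc: "card (cyc (b, s, i)) = b" for b s i
    by (simp add: cyc_def card_image inj_on_def e_inj)
  have "labeled_realization d H V \<sigma> \<rho>"
    unfolding labeled_realization_def
  proof (intro conjI ballI allI impI fin perm)
    show "\<rho> ` V \<subseteq> {1..d}" using H by (auto simp: V_def X_def \<rho>)
    fix v w assume "v \<in> V" "w \<in> orbit \<sigma> v"
    then obtain b s i j where "v = e (b, s, i, j)" "(b, s, i, j) \<in> X" by (auto simp: V_def)
    thus "\<rho> w = \<rho> v" using \<open>w \<in> _\<close> orbit by (auto simp: cyc_def \<rho>)
  next
    fix b s :: nat assume b: "1 \<le> b" and "s \<in> {1..d}"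
    have "{C \<in> orbit \<sigma> ` V. card C = b \<and> (\<forall>v\<in>C. \<rho> v = s)} = (\<lambda>i. cyc (b, s, i)) ` {..<H b s}"
    proof -
      have "(\<forall>v\<in>cyc (b', s', i). \<rho> v = s) \<longleftrightarrow> s' = s" if "i < H b' s'" for b' s' i
        using H[OF that] by (auto simp: cyc_def \<rho> lessThan_def dest: spec[of _ 0])
      thus ?thesis unfolding orbits by (auto simp: card_cyc)
    qed
    moreover have "inj_on (\<lambda>i. cyc (b, s, i)) {..<H b s}"
    proof (rule inj_onI)
      fix i i' assume "cyc (b, s, i) = cyc (b, s, i')"
      moreover have "e (b, s, i, 0) \<in> cyc (b, s, i)" using b by (auto simp: cyc_def)
      ultimately show "i = i'" by (auto simp: cyc_def e_inj)
    qed
    ultimately show "card {C \<in> orbit \<sigma> ` V. card C = b \<and> (\<forall>v\<in>C. \<rho> v = s)} = H b s"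
      by (simp add: card_image)
  qed
  thus ?thesis by blast
qed

lemma Phi_recurrence:
  assumes "normalized_state d H" "H a r > 0"
  shows "Phi d H = recurrence_rhs d (Phi d) H a r"
proof -
  obtain V :: "nat set" and \<sigma> \<rho> where real: "labeled_realization d H V \<sigma> \<rho>"
    using exists_realization[OF assms(1)] by blast
  have "card (invariant_completions V \<sigma> \<rho>) = recurrence_rhs d (Phi d) H a r"
    using real assms card_invariant_completions_eq_Phi by (rule card_invariant_completions_step)
  thus ?thesis using card_invariant_completions_eq_Phi[OF real assms(1)] by simp
qed

text \<open>Induction over proper subsets of \<open>V\<close>; whichever occupied class
  \<open>rec\<close> offers can serve as pivot, since the step holds for all of them.\<close>

lemma card_invariant_completions_by_recurrence:
  fixes V :: "'v set"
  assumes zero: "F zero_state = 1"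
    and rec: "\<And>H. normalized_state d H \<Longrightarrow> H \<noteq> zero_state \<Longrightarrow> \<exists>a r. H a r > 0 \<and> F H = recurrence_rhs d F H a r"
    and "normalized_state d H" "labeled_realization d H V \<sigma> \<rho>"
  shows "card (invariant_completions V \<sigma> \<rho>) = F H"
proof -
  have "finite V" using assms(4) by (simp add: labeled_realization_def)
  thus ?thesis using assms(3,4)
  proof (induction V arbitrary: H \<sigma> \<rho> rule: finite_psubset_induct)
    case (psubset V)
    show ?case
    proof (cases "H = zero_state")
      case True
      thus ?thesis using psubset.prems(2) realization_zero_state zero by simp
    next
      case False
      then obtain a r where ar: "H a r > 0" "F H = recurrence_rhs d F H a r"
        using rec psubset.prems(1) by blast
      show ?thesis
        unfolding ar(2) using psubset.IH
        by (intro card_invariant_completions_step[OF psubset.prems(2,1) ar(1)]) blast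
    qed
  qed
qed

text \<open>That the recurrence alone determines the count is expressed through an arbitrary
  \<open>F\<close>: a computation may choose one pivot class per state as it likes, and realizations
  on any vertex type are covered, whereas \<open>Phi\<close> itself refers to
  \<open>nat\<close>.\<close>

theorem theorem4p1:
  fixes d :: nat
  assumes "d \<ge> 1"
  shows "(\<forall>H a r. normalized_state d H \<and> H \<noteq> zero_state \<and> H a r > 0 \<longrightarrow>
            Phi d H = recurrence_rhs d (Phi d) H a r) \<and>
         Phi d zero_state = 1 \<and>
         (\<forall>F :: state \<Rightarrow> nat.
            F zero_state = 1 \<and>
            (\<forall>H. normalized_state d H \<and> H \<noteq> zero_state \<longrightarrow>
               (\<exists>a r. H a r > 0 \<and> F H = recurrence_rhs d F H a r)) \<longrightarrow>
            (\<forall>H (V :: 'v set) \<sigma> \<rho>.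
               normalized_state d H \<and> labeled_realization d H V \<sigma> \<rho> \<longrightarrow>
               card (invariant_completions V \<sigma> \<rho>) = F H))"
proof (intro conjI)
  show "\<forall>H a r. normalized_state d H \<and> H \<noteq> zero_state \<and> H a r > 0 \<longrightarrow>
      Phi d H = recurrence_rhs d (Phi d) H a r"
    using Phi_recurrence by blast
  have norm: "normalized_state d zero_state" by (simp add: normalized_state_def)
  then obtain V :: "nat set" and \<sigma> \<rho> where "labeled_realization d zero_state V \<sigma> \<rho>"
    using exists_realization by blast
  thus "Phi d zero_state = 1"
    using card_invariant_completions_eq_Phi[OF _ norm] realization_zero_state by metis
  show "\<forall>F :: state \<Rightarrow> nat. F zero_state = 1 \<and>
      (\<forall>H. normalized_state d H \<and> H \<noteq> zero_state \<longrightarrow>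
         (\<exists>a r. H a r > 0 \<and> F H = recurrence_rhs d F H a r)) \<longrightarrow>
      (\<forall>H (V :: 'v set) \<sigma> \<rho>. normalized_state d H \<and> labeled_realization d H V \<sigma> \<rho> \<longrightarrow>
         card (invariant_completions V \<sigma> \<rho>) = F H)"
  proof
    fix F :: "state \<Rightarrow> nat"
    show "F zero_state = 1 \<and>
      (\<forall>H. normalized_state d H \<and> H \<noteq> zero_state \<longrightarrow>
         (\<exists>a r. H a r > 0 \<and> F H = recurrence_rhs d F H a r)) \<longrightarrow>
      (\<forall>H (V :: 'v set) \<sigma> \<rho>. normalized_state d H \<and> labeled_realization d H V \<sigma> \<rho> \<longrightarrow>
         card (invariant_completions V \<sigma> \<rho>) = F H)"
    proof (intro impI allI)
      fix H and V :: "'v set" and \<sigma> \<rho>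
      assume F: "F zero_state = 1 \<and> (\<forall>H. normalized_state d H \<and> H \<noteq> zero_state \<longrightarrow>
          (\<exists>a r. H a r > 0 \<and> F H = recurrence_rhs d F H a r))"
        and H: "normalized_state d H \<and> labeled_realization d H V \<sigma> \<rho>"
      show "card (invariant_completions V \<sigma> \<rho>) = F H"
        using F H by (intro card_invariant_completions_by_recurrence[of F d H V \<sigma> \<rho>]) simp_all
    qed
  qed
qed

end
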